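(* Let $(L_i)_{i\in I}$ be a family of countably presented frames, and put $J=\{i\in I: L_i\text{ is nontrivial}\}$. Then the product frame $\prod_{i\in I}L_i$ is countably presented if and only if $J$ is countable.
   Context: A frame is a complete lattice $L$ with $a\wedge\bigvee S=\bigvee_{s\in S}(a\wedge s)$ for all $a\in L$, $S\subseteq L$. A frame is trivial if it has exactly one element. A frame is countably presented if it admits a presentation by generators and relations in the category of frames (morphisms preserve finite meets and arbitrary joins) with countably many generators and countably many relations (i.e. it is isomorphic to the quotient of the free frame on a countable set by the frame congruence generated by a countable set of pairs of elements). Products carry the coordinatewise order. Countable means finite or countably infinite. *)

theory Defs
  imports "HOL-Algebra.Complete_Lattice" "HOL-Library.Countable_Set" "HOL-Library.FuncSet"
begin

section \<open>Frames\<close>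

locale frame = complete_lattice +
  assumes meet_sup_distrib:
    "\<lbrakk>a \<in> carrier L; S \<subseteq> carrier L\<rbrakk> \<Longrightarrow> a \<sqinter> (\<Squnion>S) = \<Squnion>((\<lambda>s. a \<sqinter> s) ` S)"

definition trivial_frame :: "'a gorder \<Rightarrow> bool" where
  "trivial_frame L \<longleftrightarrow> (\<exists>!x. x \<in> carrier L)"

definition frame_hom :: "'a gorder \<Rightarrow> 'b gorder \<Rightarrow> ('a \<Rightarrow> 'b) \<Rightarrow> bool" where
  "frame_hom L M f \<longleftrightarrow> frame L \<and> frame M \<and> f \<in> carrier L \<rightarrow> carrier M \<and>
     f \<top>\<^bsub>L\<^esub> = \<top>\<^bsub>M\<^esub> \<and>
     (\<forall>x\<in>carrier L. \<forall>y\<in>carrier L. f (x \<sqinter>\<^bsub>L\<^esub> y) = f x \<sqinter>\<^bsub>M\<^esub> f y) \<and>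
     (\<forall>S\<subseteq>carrier L. f (\<Squnion>\<^bsub>L\<^esub> S) = \<Squnion>\<^bsub>M\<^esub> (f ` S))"

definition frame_isomorphic :: "'a gorder \<Rightarrow> 'b gorder \<Rightarrow> bool" where
  "frame_isomorphic L M \<longleftrightarrow> (\<exists>f. frame_hom L M f \<and> bij_betw f (carrier L) (carrier M))"

definition product_frame :: "'i set \<Rightarrow> ('i \<Rightarrow> 'a gorder) \<Rightarrow> ('i \<Rightarrow> 'a) gorder" where
  "product_frame I L =
     \<lparr> carrier = (\<Pi>\<^sub>E i\<in>I. carrier (L i)), eq = (=),
       le = (\<lambda>x y. \<forall>i\<in>I. x i \<sqsubseteq>\<^bsub>L i\<^esub> y i) \<rparr>"


section \<open>The free frame on a set\<close>

text \<open>
  A finite set \<open>A\<close> of generators stands for the formal meet of its elements, so that a larger set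
  is a smaller meet; an upward closed set \<open>U\<close> of such finite sets stands for the formal join of
  its members.
\<close>

definition free_frame :: "'g set \<Rightarrow> 'g set set gorder" where
  "free_frame G =
     \<lparr> carrier = {U. U \<subseteq> Fpow G \<and> (\<forall>A\<in>U. \<forall>B\<in>Fpow G. A \<subseteq> B \<longrightarrow> B \<in> U)},
       eq = (=), le = (\<subseteq>) \<rparr>"

definition free_gen :: "'g set \<Rightarrow> 'g \<Rightarrow> 'g set set" where
  "free_gen G g = {A \<in> Fpow G. g \<in> A}"


section \<open>Frame congruences and quotients\<close>

text \<open>
  A set \<open>P \<subseteq> \<theta>\<close> of pairs plays the role of a family of related pairs; the two joins below are
  those of its families of first and of second components.
\<close>

definition frame_congruence :: "'a gorder \<Rightarrow> ('a \<times> 'a) set \<Rightarrow> bool" where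
  "frame_congruence L \<theta> \<longleftrightarrow> equiv (carrier L) \<theta> \<and>
     (\<forall>(a, b)\<in>\<theta>. \<forall>(c, d)\<in>\<theta>. (a \<sqinter>\<^bsub>L\<^esub> c, b \<sqinter>\<^bsub>L\<^esub> d) \<in> \<theta>) \<and>
     (\<forall>P\<subseteq>\<theta>. (\<Squnion>\<^bsub>L\<^esub> (fst ` P), \<Squnion>\<^bsub>L\<^esub> (snd ` P)) \<in> \<theta>)"

definition generated_congruence :: "'a gorder \<Rightarrow> ('a \<times> 'a) set \<Rightarrow> ('a \<times> 'a) set" where
  "generated_congruence L R = \<Inter>{\<theta>. frame_congruence L \<theta> \<and> R \<subseteq> \<theta>}"

text \<open>The order of the quotient is that of its meet operation: \<open>[a] \<le> [b]\<close> iff \<open>[a \<and> b] = [a]\<close>.\<close>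

definition quotient_frame :: "'a gorder \<Rightarrow> ('a \<times> 'a) set \<Rightarrow> 'a set gorder" where
  "quotient_frame L \<theta> =
     \<lparr> carrier = carrier L // \<theta>, eq = (=),
       le = (\<lambda>X Y. \<exists>a\<in>X. \<exists>b\<in>Y. (a \<sqinter>\<^bsub>L\<^esub> b, a) \<in> \<theta>) \<rparr>"

text \<open>Up to bijection, the countable sets of generators are the subsets of \<open>nat\<close>.\<close>

definition countably_presented :: "'a gorder \<Rightarrow> bool" where
  "countably_presented L \<longleftrightarrow> frame L \<and>
     (\<exists>(G :: nat set) R. countable R \<and> R \<subseteq> carrier (free_frame G) \<times> carrier (free_frame G) \<and>
        frame_isomorphic L (quotient_frame (free_frame G) (generated_congruence (free_frame G) R)))"


section \<open>Adequacy of the constructions\<close>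

lemma free_frame_simps [simp]:
  "U \<in> carrier (free_frame G) \<longleftrightarrow> U \<subseteq> Fpow G \<and> (\<forall>A\<in>U. \<forall>B\<in>Fpow G. A \<subseteq> B \<longrightarrow> B \<in> U)"
  "le (free_frame G) = (\<subseteq>)" "eq (free_frame G) = (=)"
  by (auto simp: free_frame_def)

lemma free_frame_carrierD:
  assumes "U \<in> carrier (free_frame G)"
  shows "U \<subseteq> Fpow G" "\<lbrakk>A \<in> U; B \<in> Fpow G; A \<subseteq> B\<rbrakk> \<Longrightarrow> B \<in> U"
  using assms unfolding free_frame_simps by metis+

lemma free_frame_partial_order: "partial_order (free_frame G)"
  by unfold_locales auto

lemma free_frame_Union_closed:
  assumes "S \<subseteq> carrier (free_frame G)" shows "\<Union>S \<in> carrier (free_frame G)"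
  unfolding free_frame_simps
proof (intro conjI ballI impI)
  have S: "U \<subseteq> Fpow G" "\<And>A B. \<lbrakk>A \<in> U; B \<in> Fpow G; A \<subseteq> B\<rbrakk> \<Longrightarrow> B \<in> U" if "U \<in> S" for U
    using subsetD[OF assms that] unfolding free_frame_simps by metis+
  show "\<Union>S \<subseteq> Fpow G" using S(1) by (rule Union_least)
  show "B \<in> \<Union>S" if A: "A \<in> \<Union>S" and B: "B \<in> Fpow G" "A \<subseteq> B" for A B
    using A
  proof (rule UnionE)
    fix U assume "A \<in> U" "U \<in> S"
    with S(2)[of U A B] B show "B \<in> \<Union>S" by (intro UnionI) simp_all
  qed
qed

lemma free_frame_Inter_closed:
  assumes "S \<subseteq> carrier (free_frame G)" shows "\<Inter>S \<inter> Fpow G \<in> carrier (free_frame G)"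
  unfolding free_frame_simps
proof (intro conjI ballI impI IntI InterI)
  show "\<Inter>S \<inter> Fpow G \<subseteq> Fpow G" by simp
  show "B \<in> U" if A: "A \<in> \<Inter>S \<inter> Fpow G" "B \<in> Fpow G" "A \<subseteq> B" "U \<in> S" for A B U
  proof -
    have "A \<in> U" using A(1,4) by simp
    with subsetD[OF assms A(4)] A(2,3) show ?thesis unfolding free_frame_simps by metis
  qed
qed

lemma free_frame_lub:
  assumes "S \<subseteq> carrier (free_frame G)"
  shows "least (free_frame G) (\<Union>S) (Upper (free_frame G) S)"
proof (rule least_UpperI[OF _ _ assms free_frame_Union_closed[OF assms]])
  show "\<Union>S \<sqsubseteq>\<^bsub>free_frame G\<^esub> V" if "V \<in> Upper (free_frame G) S" for V
    using Upper_memD[OF that _ assms] unfolding free_frame_simps(2) by (intro Union_least) simp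
  show "U \<sqsubseteq>\<^bsub>free_frame G\<^esub> \<Union>S" if "U \<in> S" for U
    using that unfolding free_frame_simps(2) by (rule Union_upper)
qed

lemma free_frame_glb:
  assumes "S \<subseteq> carrier (free_frame G)"
  shows "greatest (free_frame G) (\<Inter>S \<inter> Fpow G) (Lower (free_frame G) S)"
proof (rule greatest_LowerI[OF _ _ assms free_frame_Inter_closed[OF assms]])
  show "V \<sqsubseteq>\<^bsub>free_frame G\<^esub> \<Inter>S \<inter> Fpow G" if V: "V \<in> Lower (free_frame G) S" for V
  proof -
    have "V \<subseteq> \<Inter>S"
      using Lower_memD[OF V _ assms] unfolding free_frame_simps(2) by (intro Inter_greatest) simp
    moreover have "V \<in> carrier (free_frame G)" using V Lower_closed by (rule rev_subsetD)
    ultimately show ?thesis by simp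
  qed
  show "\<Inter>S \<inter> Fpow G \<sqsubseteq>\<^bsub>free_frame G\<^esub> U" if "U \<in> S" for U
    using that unfolding free_frame_simps(2) by (intro le_infI1 Inter_lower)
qed

lemma free_frame_complete_lattice: "complete_lattice (free_frame G)"
proof -
  interpret partial_order "free_frame G" by (rule free_frame_partial_order)
  show ?thesis
    by unfold_locales (use free_frame_lub free_frame_glb in blast)+
qed

lemma free_frame_sup:
  assumes "S \<subseteq> carrier (free_frame G)" shows "\<Squnion>\<^bsub>free_frame G\<^esub> S = \<Union>S"
proof -
  interpret partial_order "free_frame G" by (rule free_frame_partial_order)
  show ?thesis
    using free_frame_lub[OF assms] unfolding sup_def by (metis least_unique someI)
qed

lemma free_frame_inf:
  assumes "S \<subseteq> carrier (free_frame G)" shows "\<Sqinter>\<^bsub>free_frame G\<^esub> S = \<Inter>S \<inter> Fpow G"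
proof -
  interpret partial_order "free_frame G" by (rule free_frame_partial_order)
  show ?thesis
    using free_frame_glb[OF assms] unfolding inf_def by (metis greatest_unique someI)
qed

lemma free_frame_meet:
  assumes "U \<in> carrier (free_frame G)" "V \<in> carrier (free_frame G)"
  shows "U \<sqinter>\<^bsub>free_frame G\<^esub> V = U \<inter> V"
proof -
  have "{U, V} \<subseteq> carrier (free_frame G)" using assms by blast
  with assms show ?thesis by (auto simp: meet_def free_frame_inf)
qed

lemma free_frame_frame: "frame (free_frame G)"
proof -
  interpret complete_lattice "free_frame G" by (rule free_frame_complete_lattice)
  show ?thesis
  proof
    fix a S assume a: "a \<in> carrier (free_frame G)" and S: "S \<subseteq> carrier (free_frame G)"
    have m: "a \<sqinter>\<^bsub>free_frame G\<^esub> s = a \<inter> s" if "s \<in> S" for s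
      using free_frame_meet[OF a subsetD[OF S that]] .
    have *: "(\<lambda>s. a \<inter> s) ` S \<subseteq> carrier (free_frame G)"
    proof (rule image_subsetI)
      fix s assume s: "s \<in> S"
      show "a \<inter> s \<in> carrier (free_frame G)"
        using meet_closed[OF a subsetD[OF S s]] unfolding m[OF s] .
    qed
    have "a \<sqinter>\<^bsub>free_frame G\<^esub> (\<Squnion>\<^bsub>free_frame G\<^esub> S) = a \<inter> \<Union>S"
      using free_frame_meet[OF a free_frame_Union_closed[OF S]] unfolding free_frame_sup[OF S] .
    also have "\<dots> = \<Squnion>\<^bsub>free_frame G\<^esub> ((\<lambda>s. a \<inter> s) ` S)"
      unfolding free_frame_sup[OF *] by (rule Int_Union)
    also have "(\<lambda>s. a \<inter> s) ` S = (\<lambda>s. a \<sqinter>\<^bsub>free_frame G\<^esub> s) ` S"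
      using m by (intro image_cong) simp_all
    finally show "a \<sqinter>\<^bsub>free_frame G\<^esub> (\<Squnion>\<^bsub>free_frame G\<^esub> S) =
      \<Squnion>\<^bsub>free_frame G\<^esub> ((\<lambda>s. a \<sqinter>\<^bsub>free_frame G\<^esub> s) ` S)" .
  qed
qed

lemma free_frame_top: "\<top>\<^bsub>free_frame G\<^esub> = Fpow G"
proof -
  interpret complete_lattice "free_frame G" by (rule free_frame_complete_lattice)
  have F: "Fpow G \<in> carrier (free_frame G)" by simp
  show ?thesis
  proof (rule subset_antisym)
    show "\<top>\<^bsub>free_frame G\<^esub> \<subseteq> Fpow G" using top_closed unfolding free_frame_simps(1) by (rule conjunct1)
    show "Fpow G \<subseteq> \<top>\<^bsub>free_frame G\<^esub>" using top_higher[OF F] unfolding free_frame_simps(2) .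
  qed
qed

lemma free_gen_closed: "free_gen G g \<in> carrier (free_frame G)"
  by (auto simp: free_gen_def)

context frame
begin

lemma sup_meet_sup:
  assumes "S \<subseteq> carrier L" "T \<subseteq> carrier L"
  shows "\<Squnion>S \<sqinter> \<Squnion>T \<sqsubseteq> \<Squnion>{s \<sqinter> t | s t. s \<in> S \<and> t \<in> T}" (is "_ \<sqsubseteq> \<Squnion>?P")
proof -
  have P: "?P \<subseteq> carrier L" using subsetD[OF assms(1)] subsetD[OF assms(2)] by auto
  have c: "\<Squnion>S \<in> carrier L" using assms by simp
  have "\<Squnion>S \<sqinter> \<Squnion>T = \<Squnion>((\<lambda>t. \<Squnion>S \<sqinter> t) ` T)" using c assms by (simp add: meet_sup_distrib)
  also have "\<dots> \<sqsubseteq> \<Squnion>?P"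
  proof (rule sup_least)
    show "(\<lambda>t. \<Squnion>S \<sqinter> t) ` T \<subseteq> carrier L" using c assms by auto
    show "\<Squnion>?P \<in> carrier L" using P by simp
    fix x assume "x \<in> (\<lambda>t. \<Squnion>S \<sqinter> t) ` T"
    then obtain t where t: "t \<in> T" "x = \<Squnion>S \<sqinter> t" by blast
    have tc: "t \<in> carrier L" using t assms by auto
    have "x = t \<sqinter> \<Squnion>S" using t c tc by (simp add: meet_comm)
    also have "\<dots> = \<Squnion>((\<lambda>s. t \<sqinter> s) ` S)" using tc assms by (simp add: meet_sup_distrib)
    also have "(\<lambda>s. t \<sqinter> s) ` S = (\<lambda>s. s \<sqinter> t) ` S"
      by (rule image_cong[OF HOL.refl meet_comm])
    also have "\<Squnion>((\<lambda>s. s \<sqinter> t) ` S) \<sqsubseteq> \<Squnion>?P"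
      using assms t P tc by (intro sup_least) (auto intro!: sup_upper)
    finally show "x \<sqsubseteq> \<Squnion>?P" .
  qed
  finally show ?thesis .
qed

end

lemma free_frame_extension:
  assumes M: "frame M" and f: "f \<in> G \<rightarrow> carrier M"
  shows "\<exists>h. frame_hom (free_frame G) M h \<and> (\<forall>g\<in>G. h (free_gen G g) = f g)"
proof -
  interpret M: frame M by (rule M)
  define m where "m A = \<Sqinter>\<^bsub>M\<^esub> (f ` A)" for A
  define h where "h U = \<Squnion>\<^bsub>M\<^esub> (m ` U)" for U
  have fA: "f ` A \<subseteq> carrier M" if "A \<in> Fpow G" for A using f that by (auto simp: Fpow_def)
  have m_closed: "m A \<in> carrier M" if "A \<in> Fpow G" for A
    using fA[OF that] by (simp add: m_def)
  have mU: "m ` U \<subseteq> carrier M" if "U \<subseteq> Fpow G" for U using m_closed that by auto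
  have h_closed: "h U \<in> carrier M" if "U \<subseteq> Fpow G" for U using mU[OF that] by (simp add: h_def)
  have h_upper: "m A \<sqsubseteq>\<^bsub>M\<^esub> h U" if "A \<in> U" "U \<subseteq> Fpow G" for A U
    using that mU unfolding h_def by (intro M.sup_upper) auto
  have h_least: "h U \<sqsubseteq>\<^bsub>M\<^esub> z" if "\<And>A. A \<in> U \<Longrightarrow> m A \<sqsubseteq>\<^bsub>M\<^esub> z" "z \<in> carrier M" "U \<subseteq> Fpow G" for U z
    using that mU unfolding h_def by (intro M.sup_least) auto
  have h_mono: "h U \<sqsubseteq>\<^bsub>M\<^esub> h V" if "U \<subseteq> V" "V \<subseteq> Fpow G" for U V
    using that by (intro h_least h_closed h_upper) auto
  have m_lower: "m A \<sqsubseteq>\<^bsub>M\<^esub> f g" if "A \<in> Fpow G" "g \<in> A" for A g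
    unfolding m_def using that fA by (intro M.inf_lower) auto
  have m_meet: "m A \<sqinter>\<^bsub>M\<^esub> m B \<sqsubseteq>\<^bsub>M\<^esub> m (A \<union> B)" if AB: "A \<in> Fpow G" "B \<in> Fpow G" for A B
    unfolding m_def[of "A \<union> B"]
  proof (rule M.inf_greatest)
    note c = m_closed[OF AB(1)] m_closed[OF AB(2)]
    show "f ` (A \<union> B) \<subseteq> carrier M" using fA AB by auto
    show "m A \<sqinter>\<^bsub>M\<^esub> m B \<in> carrier M" using c by simp
    fix x assume "x \<in> f ` (A \<union> B)"
    then obtain g where g: "g \<in> A \<or> g \<in> B" "x = f g" by blast
    have xc: "x \<in> carrier M" using g fA AB by auto
    from g show "m A \<sqinter>\<^bsub>M\<^esub> m B \<sqsubseteq>\<^bsub>M\<^esub> x"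
      using m_lower AB c xc M.meet_left M.meet_right M.le_trans M.meet_closed by metis
  qed
  have "frame_hom (free_frame G) M h"
    unfolding frame_hom_def
  proof (intro conjI ballI allI impI)
    show "frame (free_frame G)" by (rule free_frame_frame)
    show "frame M" by (rule M)
    show "h \<in> carrier (free_frame G) \<rightarrow> carrier M" by (intro funcsetI h_closed free_frame_carrierD(1))
    have "m {} = \<top>\<^bsub>M\<^esub>" using M.weak_inf_empty by (simp add: m_def M.eq_is_equal)
    then have "\<top>\<^bsub>M\<^esub> \<sqsubseteq>\<^bsub>M\<^esub> h (Fpow G)" using h_upper[of "{}" "Fpow G"] by (simp add: Fpow_def)
    then show "h \<top>\<^bsub>free_frame G\<^esub> = \<top>\<^bsub>M\<^esub>"
      using h_closed[of "Fpow G"] by (simp add: free_frame_top M.le_antisym)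
  next
    fix U V assume U: "U \<in> carrier (free_frame G)" and V: "V \<in> carrier (free_frame G)"
    then have UV: "U \<subseteq> Fpow G" "V \<subseteq> Fpow G" "U \<inter> V \<subseteq> Fpow G"
      by (simp_all add: free_frame_carrierD(1) le_infI1)
    have "h (U \<inter> V) = h U \<sqinter>\<^bsub>M\<^esub> h V"
    proof (rule M.le_antisym)
      show c: "h (U \<inter> V) \<in> carrier M" "h U \<sqinter>\<^bsub>M\<^esub> h V \<in> carrier M"
        using UV h_closed by auto
      show "h (U \<inter> V) \<sqsubseteq>\<^bsub>M\<^esub> h U \<sqinter>\<^bsub>M\<^esub> h V"
        using UV h_closed h_mono by (intro M.meet_le) auto
      let ?P = "{s \<sqinter>\<^bsub>M\<^esub> t | s t. s \<in> m ` U \<and> t \<in> m ` V}"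
      have Pc: "?P \<subseteq> carrier M"
      proof clarify
        fix A B assume "A \<in> U" "B \<in> V"
        then have "m A \<in> carrier M" "m B \<in> carrier M" using UV m_closed by blast+
        then show "m A \<sqinter>\<^bsub>M\<^esub> m B \<in> carrier M" by (rule M.meet_closed)
      qed
      have "h U \<sqinter>\<^bsub>M\<^esub> h V \<sqsubseteq>\<^bsub>M\<^esub> \<Squnion>\<^bsub>M\<^esub> ?P"
        unfolding h_def using mU UV by (intro M.sup_meet_sup) auto
      also have "\<Squnion>\<^bsub>M\<^esub> ?P \<sqsubseteq>\<^bsub>M\<^esub> h (U \<inter> V)"
      proof (rule M.sup_least[OF Pc c(1)])
        fix x assume "x \<in> ?P"
        then obtain A B where AB: "A \<in> U" "B \<in> V" "x = m A \<sqinter>\<^bsub>M\<^esub> m B" by blast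
        have F: "A \<in> Fpow G" "B \<in> Fpow G" "A \<union> B \<in> Fpow G" using AB UV by (auto simp: Fpow_def)
        have "A \<union> B \<in> U \<inter> V"
          using free_frame_carrierD(2)[OF U AB(1) F(3)] free_frame_carrierD(2)[OF V AB(2) F(3)] by simp
        then have le: "m (A \<union> B) \<sqsubseteq>\<^bsub>M\<^esub> h (U \<inter> V)" using UV(3) by (rule h_upper)
        show "x \<sqsubseteq>\<^bsub>M\<^esub> h (U \<inter> V)"
          unfolding AB(3)
          by (rule M.le_trans[OF m_meet[OF F(1,2)] le]) (simp_all add: m_closed F c(1))
      qed
      finally show "h U \<sqinter>\<^bsub>M\<^esub> h V \<sqsubseteq>\<^bsub>M\<^esub> h (U \<inter> V)"
        using c Pc by simp
    qed
    then show "h (U \<sqinter>\<^bsub>free_frame G\<^esub> V) = h U \<sqinter>\<^bsub>M\<^esub> h V"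
      using free_frame_meet[OF U V] by simp
  next
    fix S assume S: "S \<subseteq> carrier (free_frame G)"
    have SF: "U \<subseteq> Fpow G" if "U \<in> S" for U
      using free_frame_carrierD(1)[OF subsetD[OF S that]] .
    then have uF: "\<Union>S \<subseteq> Fpow G" by blast
    have hS: "h ` S \<subseteq> carrier M" using SF h_closed by auto
    have "h (\<Union>S) = \<Squnion>\<^bsub>M\<^esub> (h ` S)"
    proof (rule M.le_antisym)
      show c: "h (\<Union>S) \<in> carrier M" "\<Squnion>\<^bsub>M\<^esub> (h ` S) \<in> carrier M" using h_closed uF hS by auto
      show "\<Squnion>\<^bsub>M\<^esub> (h ` S) \<sqsubseteq>\<^bsub>M\<^esub> h (\<Union>S)"
      proof (rule M.sup_least[OF hS c(1)])
        fix x assume "x \<in> h ` S"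
        then obtain U where U: "U \<in> S" "x = h U" by blast
        then show "x \<sqsubseteq>\<^bsub>M\<^esub> h (\<Union>S)" using h_mono[OF Union_upper[OF U(1)] uF] by simp
      qed
      show "h (\<Union>S) \<sqsubseteq>\<^bsub>M\<^esub> \<Squnion>\<^bsub>M\<^esub> (h ` S)"
      proof (rule h_least[OF _ c(2) uF])
        fix A assume "A \<in> \<Union>S"
        then obtain U where U: "U \<in> S" "A \<in> U" by blast
        have le1: "h U \<sqsubseteq>\<^bsub>M\<^esub> \<Squnion>\<^bsub>M\<^esub> (h ` S)" using hS U by (intro M.sup_upper) auto
        have le2: "m A \<sqsubseteq>\<^bsub>M\<^esub> h U" by (rule h_upper[OF U(2) SF[OF U(1)]])
        show "m A \<sqsubseteq>\<^bsub>M\<^esub> \<Squnion>\<^bsub>M\<^esub> (h ` S)"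
          by (rule M.le_trans[OF le2 le1])
            (use c(2) m_closed[OF subsetD[OF SF[OF U(1)] U(2)]] h_closed[OF SF[OF U(1)]] in simp_all)
      qed
    qed
    then show "h (\<Squnion>\<^bsub>free_frame G\<^esub> S) = \<Squnion>\<^bsub>M\<^esub> (h ` S)"
      using free_frame_sup[OF S] by simp
  qed
  moreover have "h (free_gen G g) = f g" if g: "g \<in> G" for g
  proof (rule M.le_antisym)
    have F: "free_gen G g \<subseteq> Fpow G" "{g} \<in> free_gen G g" using g by (auto simp: free_gen_def Fpow_def)
    show c: "h (free_gen G g) \<in> carrier M" "f g \<in> carrier M" using F h_closed f g by auto
    show "h (free_gen G g) \<sqsubseteq>\<^bsub>M\<^esub> f g"
      using F c m_lower by (intro h_least) (auto simp: free_gen_def)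
    show "f g \<sqsubseteq>\<^bsub>M\<^esub> h (free_gen G g)"
      using h_upper[OF F(2,1)] c by (simp add: m_def)
  qed
  ultimately show ?thesis by blast
qed

lemma frame_homD:
  assumes "frame_hom L M f"
  shows "f \<top>\<^bsub>L\<^esub> = \<top>\<^bsub>M\<^esub>"
    and "\<lbrakk>x \<in> carrier L; y \<in> carrier L\<rbrakk> \<Longrightarrow> f (x \<sqinter>\<^bsub>L\<^esub> y) = f x \<sqinter>\<^bsub>M\<^esub> f y"
    and "S \<subseteq> carrier L \<Longrightarrow> f (\<Squnion>\<^bsub>L\<^esub> S) = \<Squnion>\<^bsub>M\<^esub> (f ` S)"
  using assms by (simp_all add: frame_hom_def)

lemma free_frame_extension_unique:
  assumes h: "frame_hom (free_frame G) M h" and k: "frame_hom (free_frame G) M k"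
    and eq: "\<And>g. g \<in> G \<Longrightarrow> h (free_gen G g) = k (free_gen G g)"
    and U: "U \<in> carrier (free_frame G)"
  shows "h U = k U"
proof -
  define up where "up A = {B \<in> Fpow G. A \<subseteq> B}" for A
  have upc: "up A \<in> carrier (free_frame G)" for A by (auto simp: up_def)
  have up_eq: "h (up A) = k (up A)" if "finite A" "A \<subseteq> G" for A
    using that
  proof (induction A)
    case empty
    have "up {} = \<top>\<^bsub>free_frame G\<^esub>" by (auto simp: up_def free_frame_top)
    then show ?case using frame_homD(1)[OF h] frame_homD(1)[OF k] by simp
  next
    case (insert g A)
    have ins: "up (insert g A) = free_gen G g \<sqinter>\<^bsub>free_frame G\<^esub> up A"
      unfolding free_frame_meet[OF free_gen_closed upc] by (auto simp: up_def free_gen_def)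
    have hom: "f (up (insert g A)) = f (free_gen G g) \<sqinter>\<^bsub>M\<^esub> f (up A)"
      if "frame_hom (free_frame G) M f" for f
      unfolding ins by (rule frame_homD(2)[OF that free_gen_closed upc])
    show ?case using hom[OF h] hom[OF k] insert.IH insert.prems eq[of g] by simp
  qed
  have S: "up ` U \<subseteq> carrier (free_frame G)" using upc by blast
  have "\<Union>(up ` U) = U"
  proof (rule subset_antisym)
    show "\<Union>(up ` U) \<subseteq> U"
      using free_frame_carrierD(2)[OF U] by (intro Union_least) (auto simp: up_def)
    show "U \<subseteq> \<Union>(up ` U)"
    proof
      fix A assume "A \<in> U"
      moreover have "A \<in> up A"
        using \<open>A \<in> U\<close> free_frame_carrierD(1)[OF U] by (auto simp: up_def)
      ultimately show "A \<in> \<Union>(up ` U)" by (rule UN_I)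
    qed
  qed
  then have "\<Squnion>\<^bsub>free_frame G\<^esub> (up ` U) = U" using free_frame_sup[OF S] by simp
  moreover have sup_pres: "f (\<Squnion>\<^bsub>free_frame G\<^esub> (up ` U)) = \<Squnion>\<^bsub>M\<^esub> (f ` up ` U)"
    if "frame_hom (free_frame G) M f" for f
    by (rule frame_homD(3)[OF that S])
  moreover have "h ` up ` U = k ` up ` U"
    using free_frame_carrierD(1)[OF U] up_eq unfolding image_image
    by (intro image_cong) (auto simp: Fpow_def)
  ultimately show ?thesis using sup_pres[OF h] sup_pres[OF k] by simp
qed

lemma generated_congruence:
  fixes L :: "'a gorder" (structure)
  assumes "frame L" "R \<subseteq> carrier L \<times> carrier L"
  shows "frame_congruence L (generated_congruence L R)" "R \<subseteq> generated_congruence L R"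
proof -
  interpret frame L by (rule assms)
  let ?C = "{\<theta>. frame_congruence L \<theta> \<and> R \<subseteq> \<theta>}"
  have full: "carrier L \<times> carrier L \<in> ?C"
  proof -
    have "fst ` P \<subseteq> carrier L \<and> snd ` P \<subseteq> carrier L" if "P \<subseteq> carrier L \<times> carrier L" for P
      using that by auto
    then show ?thesis using assms(2)
      by (simp add: frame_congruence_def equiv_def refl_on_def sym_def trans_def)
  qed
  have "equiv (carrier L) (\<Inter>?C)"
  proof (rule equivI)
    show "\<Inter>?C \<subseteq> carrier L \<times> carrier L" using full by blast
    show "refl_on (carrier L) (\<Inter>?C)"
      by (auto simp: refl_on_def frame_congruence_def equiv_def)
    show "sym (\<Inter>?C)" by (rule symI) (auto simp: frame_congruence_def equiv_def dest: symD)
    show "trans (\<Inter>?C)"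
      by (rule transI) (auto simp: frame_congruence_def equiv_def dest: transD)
  qed
  moreover have "(a \<sqinter> c, b \<sqinter> d) \<in> \<Inter>?C" if "(a, b) \<in> \<Inter>?C" "(c, d) \<in> \<Inter>?C" for a b c d
  proof (rule InterI)
    fix \<theta> assume "\<theta> \<in> ?C"
    with that have "(a, b) \<in> \<theta>" "(c, d) \<in> \<theta>" "frame_congruence L \<theta>" by auto
    then show "(a \<sqinter> c, b \<sqinter> d) \<in> \<theta>" unfolding frame_congruence_def by blast
  qed
  then have "\<forall>(a, b)\<in>\<Inter>?C. \<forall>(c, d)\<in>\<Inter>?C. (a \<sqinter> c, b \<sqinter> d) \<in> \<Inter>?C"
    by (intro ballI case_prodI2) simp
  moreover have "\<forall>P\<subseteq>\<Inter>?C. (\<Squnion>(fst ` P), \<Squnion>(snd ` P)) \<in> \<Inter>?C"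
  proof (intro allI impI InterI)
    fix P \<theta> assume "P \<subseteq> \<Inter>?C" "\<theta> \<in> ?C"
    then have "P \<subseteq> \<theta>" "frame_congruence L \<theta>" by auto
    then show "(\<Squnion>(fst ` P), \<Squnion>(snd ` P)) \<in> \<theta>" unfolding frame_congruence_def by blast
  qed
  ultimately have "frame_congruence L (\<Inter>?C)"
    unfolding frame_congruence_def[of L "\<Inter>?C"] by (intro conjI)
  then show "frame_congruence L (generated_congruence L R)"
    by (simp only: generated_congruence_def)
  show "R \<subseteq> generated_congruence L R" by (auto simp: generated_congruence_def)
qed

lemma quotient_frame_projection:
  fixes L :: "'a gorder" (structure)
  assumes L: "frame L" and \<theta>: "frame_congruence L \<theta>"
  shows "frame_hom L (quotient_frame L \<theta>) (\<lambda>x. \<theta> `` {x})"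
proof -
  interpret frame L by (rule L)
  let ?Q = "quotient_frame L \<theta>"
  define p where "p x = \<theta> `` {x}" for x
  have eqv: "equiv (carrier L) \<theta>" using \<theta> by (simp add: frame_congruence_def)
  have meet_c: "(a \<sqinter> c, b \<sqinter> d) \<in> \<theta>" if "(a, b) \<in> \<theta>" "(c, d) \<in> \<theta>" for a b c d
  proof -
    have "\<forall>x\<in>\<theta>. \<forall>y\<in>\<theta>. (fst x \<sqinter> fst y, snd x \<sqinter> snd y) \<in> \<theta>"
      using \<theta> by (simp add: frame_congruence_def split_beta)
    from bspec[OF bspec[OF this that(1)] that(2)] show ?thesis by simp
  qed
  have sup_c: "(\<Squnion>(f ` A), \<Squnion>(g ` A)) \<in> \<theta>" if "\<And>a. a \<in> A \<Longrightarrow> (f a, g a) \<in> \<theta>"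
    for A :: "'a set" and f g
  proof -
    have "(\<lambda>a. (f a, g a)) ` A \<subseteq> \<theta>" using that by (intro image_subsetI)
    then have "(\<Squnion>(fst ` (\<lambda>a. (f a, g a)) ` A), \<Squnion>(snd ` (\<lambda>a. (f a, g a)) ` A)) \<in> \<theta>"
      using \<theta> unfolding frame_congruence_def by blast
    then show ?thesis by (simp only: image_image fst_conv snd_conv)
  qed
  have r: "(x, x) \<in> \<theta>" if "x \<in> carrier L" for x using eqv that by (simp add: equiv_def refl_on_def)
  have s: "(y, x) \<in> \<theta>" if "(x, y) \<in> \<theta>" for x y using eqv that by (simp add: equiv_def symD)
  have t: "(x, z) \<in> \<theta>" if "(x, y) \<in> \<theta>" "(y, z) \<in> \<theta>" for x y z
    by (rule transD[OF _ that]) (use eqv in \<open>simp add: equiv_def\<close>)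
  have c: "x \<in> carrier L" "y \<in> carrier L" if "(x, y) \<in> \<theta>" for x y
  proof -
    have "\<theta> \<subseteq> carrier L \<times> carrier L" using eqv by (simp add: equiv_def)
    from subsetD[OF this that] show "x \<in> carrier L" "y \<in> carrier L" by simp_all
  qed
  have p_eq: "p x = p y \<longleftrightarrow> (x, y) \<in> \<theta>" if "x \<in> carrier L" "y \<in> carrier L" for x y
    using eq_equiv_class_iff[OF eqv that] by (simp add: p_def)
  have Q_carrier: "carrier ?Q = p ` carrier L"
    unfolding quotient_frame_def quotient_def p_def by auto
  have Q_eq: "eq ?Q = (=)" by (simp add: quotient_frame_def)
  have Q_le: "p x \<sqsubseteq>\<^bsub>?Q\<^esub> p y \<longleftrightarrow> (x \<sqinter> y, x) \<in> \<theta>" if xy: "x \<in> carrier L" "y \<in> carrier L" for x y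
  proof
    assume "p x \<sqsubseteq>\<^bsub>?Q\<^esub> p y"
    then have "\<exists>a\<in>p x. \<exists>b\<in>p y. (a \<sqinter> b, a) \<in> \<theta>" by (simp add: quotient_frame_def)
    then obtain a b where "a \<in> p x" "b \<in> p y" and "(a \<sqinter> b, a) \<in> \<theta>" by (elim bexE)
    then have ab: "(x, a) \<in> \<theta>" "(y, b) \<in> \<theta>" "(a \<sqinter> b, a) \<in> \<theta>" by (simp_all add: p_def)
    show "(x \<sqinter> y, x) \<in> \<theta>" by (rule t[OF meet_c[OF ab(1,2)] t[OF ab(3) s[OF ab(1)]]])
  next
    assume "(x \<sqinter> y, x) \<in> \<theta>"
    moreover have "x \<in> p x" "y \<in> p y" using r xy by (simp_all add: p_def)
    ultimately have "\<exists>a\<in>p x. \<exists>b\<in>p y. (a \<sqinter> b, a) \<in> \<theta>" by (intro bexI)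
    then show "p x \<sqsubseteq>\<^bsub>?Q\<^esub> p y" by (simp add: quotient_frame_def)
  qed
  have le: "p x \<sqsubseteq>\<^bsub>?Q\<^esub> p y" if "x \<sqsubseteq> y" "x \<in> carrier L" "y \<in> carrier L" for x y
  proof -
    have "x \<sqinter> y = x" using iffD1[OF le_iff_join[OF that(2,3)] that(1)] by (rule HOL.sym)
    then show ?thesis using Q_le[OF that(2,3)] r[OF that(2)] by simp
  qed
  have Q_trans: "p x \<sqsubseteq>\<^bsub>?Q\<^esub> p z" if "p x \<sqsubseteq>\<^bsub>?Q\<^esub> p y" "p y \<sqsubseteq>\<^bsub>?Q\<^esub> p z"
    and xyz: "x \<in> carrier L" "y \<in> carrier L" "z \<in> carrier L" for x y z
  proof -
    have xy: "(x \<sqinter> y, x) \<in> \<theta>" and yz: "(y \<sqinter> z, y) \<in> \<theta>"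
      using that(1,2) by (simp_all only: Q_le xyz)
    have "(x \<sqinter> z, (x \<sqinter> y) \<sqinter> z) \<in> \<theta>" by (rule meet_c[OF s[OF xy] r[OF xyz(3)]])
    also have "(x \<sqinter> y) \<sqinter> z = x \<sqinter> (y \<sqinter> z)" by (rule meet_assoc[OF xyz])
    finally have "(x \<sqinter> z, x \<sqinter> (y \<sqinter> z)) \<in> \<theta>" .
    from t[OF this t[OF meet_c[OF r[OF xyz(1)] yz] xy]] show ?thesis by (simp only: Q_le xyz)
  qed
  have Q_antisym: "p x = p y" if "p x \<sqsubseteq>\<^bsub>?Q\<^esub> p y" "p y \<sqsubseteq>\<^bsub>?Q\<^esub> p x"
    and xy: "x \<in> carrier L" "y \<in> carrier L" for x y
  proof -
    have m1: "(x \<sqinter> y, x) \<in> \<theta>" and m2: "(y \<sqinter> x, y) \<in> \<theta>"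
      using that(1,2) by (simp_all only: Q_le xy)
    have "(x \<sqinter> y, y) \<in> \<theta>" using m2 by (subst meet_comm)
    from t[OF s[OF m1] this] have "(x, y) \<in> \<theta>" .
    then show ?thesis using p_eq[OF xy] by simp
  qed
  have "partial_order ?Q"
  proof
    show "x \<sqsubseteq>\<^bsub>?Q\<^esub> x" if "x \<in> carrier ?Q" for x
      using that le unfolding Q_carrier by blast
    show "x .=\<^bsub>?Q\<^esub> y" if "x \<sqsubseteq>\<^bsub>?Q\<^esub> y" "y \<sqsubseteq>\<^bsub>?Q\<^esub> x" "x \<in> carrier ?Q" "y \<in> carrier ?Q" for x y
      using that Q_antisym unfolding Q_carrier Q_eq by blast
    show "x \<sqsubseteq>\<^bsub>?Q\<^esub> z"
      if "x \<sqsubseteq>\<^bsub>?Q\<^esub> y" "y \<sqsubseteq>\<^bsub>?Q\<^esub> z" "x \<in> carrier ?Q" "y \<in> carrier ?Q" "z \<in> carrier ?Q" for x y z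
      using that Q_trans unfolding Q_carrier by blast
  qed (simp_all add: Q_eq)
  then interpret Q: partial_order ?Q .
  have p_closed: "p x \<in> carrier ?Q" if "x \<in> carrier L" for x using that by (simp add: Q_carrier)
  have lub: "least ?Q (p (\<Squnion>A)) (Upper ?Q (p ` A))" if A: "A \<subseteq> carrier L" for A
  proof (rule least_UpperI)
    have sA: "\<Squnion>A \<in> carrier L" using A by simp
    show pA: "p ` A \<subseteq> carrier ?Q" using subsetD[OF A] p_closed by (intro image_subsetI) simp
    show "p (\<Squnion>A) \<in> carrier ?Q" by (rule p_closed[OF sA])
    show "x \<sqsubseteq>\<^bsub>?Q\<^esub> p (\<Squnion>A)" if "x \<in> p ` A" for x
    proof -
      from that obtain a where a: "a \<in> A" "x = p a" by blast
      show ?thesis unfolding a(2) by (rule le[OF sup_upper[OF A a(1)] subsetD[OF A a(1)] sA])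
    qed
    fix Y assume Y: "Y \<in> Upper ?Q (p ` A)"
    have "Y \<in> p ` carrier L" using subsetD[OF Upper_closed Y] unfolding Q_carrier .
    then obtain y where y: "y \<in> carrier L" "Y = p y" by blast
    have "(y \<sqinter> a, a) \<in> \<theta>" if a: "a \<in> A" for a
    proof -
      have "p a \<sqsubseteq>\<^bsub>?Q\<^esub> p y" using Upper_memD[OF Y imageI[OF a] pA] y(2) by simp
      then have "(a \<sqinter> y, a) \<in> \<theta>" by (simp only: Q_le[OF subsetD[OF A a] y(1)])
      then show ?thesis by (subst meet_comm)
    qed
    then have "(\<Squnion>((\<lambda>a. y \<sqinter> a) ` A), \<Squnion>((\<lambda>a. a) ` A)) \<in> \<theta>" by (rule sup_c)
    then have "(y \<sqinter> \<Squnion>A, \<Squnion>A) \<in> \<theta>" by (simp only: meet_sup_distrib[OF y(1) A] image_ident)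
    then have "(\<Squnion>A \<sqinter> y, \<Squnion>A) \<in> \<theta>" by (subst meet_comm)
    then show "p (\<Squnion>A) \<sqsubseteq>\<^bsub>?Q\<^esub> Y" by (simp only: y(2) Q_le[OF sA y(1)])
  qed
  have glb: "\<exists>X. greatest ?Q X (Lower ?Q (p ` A))" if A: "A \<subseteq> carrier L" for A
  proof -
    define B where "B = {b \<in> carrier L. \<forall>a\<in>A. p b \<sqsubseteq>\<^bsub>?Q\<^esub> p a}"
    have B: "B \<subseteq> carrier L" by (auto simp: B_def)
    have "greatest ?Q (p (\<Squnion>B)) (Lower ?Q (p ` A))"
    proof (rule greatest_LowerI)
      show pA: "p ` A \<subseteq> carrier ?Q" using subsetD[OF A] p_closed by (intro image_subsetI) simp
      show "p (\<Squnion>B) \<in> carrier ?Q" by (rule p_closed[OF sup_closed[OF B]])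
      show "p (\<Squnion>B) \<sqsubseteq>\<^bsub>?Q\<^esub> x" if "x \<in> p ` A" for x
      proof -
        from that obtain a where a: "a \<in> A" "x = p a" by blast
        have "x \<in> Upper ?Q (p ` B)"
          unfolding a(2) using p_closed[OF subsetD[OF A a(1)]] a(1)
          by (intro Upper_memI) (auto simp: B_def)
        then show ?thesis using lub[OF B] by (simp add: least_def)
      qed
      fix Y assume Y: "Y \<in> Lower ?Q (p ` A)"
      have "Y \<in> p ` carrier L" using subsetD[OF Lower_closed Y] unfolding Q_carrier .
      then obtain y where y: "y \<in> carrier L" "Y = p y" by blast
      have "p y \<sqsubseteq>\<^bsub>?Q\<^esub> p a" if a: "a \<in> A" for a
        using Lower_memD[OF Y imageI[OF a] pA] y(2) by simp
      then have "y \<in> B" using y by (simp add: B_def)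
      from le[OF sup_upper[OF B this] y(1) sup_closed[OF B]]
      show "Y \<sqsubseteq>\<^bsub>?Q\<^esub> p (\<Squnion>B)" unfolding y(2) .
    qed
    then show ?thesis by blast
  qed
  have lift: "\<exists>A\<subseteq>carrier L. S = p ` A" if "S \<subseteq> carrier ?Q" for S
    using that unfolding Q_carrier subset_image_iff .
  have "complete_lattice ?Q"
  proof
    fix S assume "S \<subseteq> carrier ?Q"
    then obtain A where A: "A \<subseteq> carrier L" "S = p ` A" using lift by blast
    show "\<exists>s. least ?Q s (Upper ?Q S)" using lub[OF A(1)] A(2) by blast
    show "\<exists>i. greatest ?Q i (Lower ?Q S)" using glb[OF A(1)] A(2) by blast
  qed
  then interpret Q: complete_lattice ?Q .
  have p_sup: "p (\<Squnion>A) = \<Squnion>\<^bsub>?Q\<^esub> (p ` A)" if A: "A \<subseteq> carrier L" for A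
  proof -
    have "p ` A \<subseteq> carrier ?Q" using A p_closed by blast
    from Q.least_unique[OF lub[OF A] Q.sup_lub[OF this]] show ?thesis .
  qed
  have p_meet: "p (x \<sqinter> y) = p x \<sqinter>\<^bsub>?Q\<^esub> p y" if xy: "x \<in> carrier L" "y \<in> carrier L" for x y
  proof (rule Q.le_antisym)
    have xyc: "x \<sqinter> y \<in> carrier L" using xy by simp
    show cl: "p (x \<sqinter> y) \<in> carrier ?Q" "p x \<sqinter>\<^bsub>?Q\<^esub> p y \<in> carrier ?Q"
      using xy xyc p_closed by simp_all
    show "p (x \<sqinter> y) \<sqsubseteq>\<^bsub>?Q\<^esub> p x \<sqinter>\<^bsub>?Q\<^esub> p y"
      using xy xyc p_closed by (intro Q.meet_le le) (simp_all add: meet_left meet_right)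
    obtain z where z: "z \<in> carrier L" "p x \<sqinter>\<^bsub>?Q\<^esub> p y = p z" using cl(2) Q_carrier by blast
    have "p z \<sqsubseteq>\<^bsub>?Q\<^esub> p x" "p z \<sqsubseteq>\<^bsub>?Q\<^esub> p y"
      using Q.meet_left[OF p_closed[OF xy(1)] p_closed[OF xy(2)]]
        Q.meet_right[OF p_closed[OF xy(1)] p_closed[OF xy(2)]] z(2) by simp_all
    then have zx: "(z \<sqinter> x, z) \<in> \<theta>" and zy: "(z \<sqinter> y, z) \<in> \<theta>" using Q_le z(1) xy by simp_all
    have "((z \<sqinter> x) \<sqinter> y, z) \<in> \<theta>" by (rule t[OF meet_c[OF zx r[OF xy(2)]] zy])
    then have "(z \<sqinter> (x \<sqinter> y), z) \<in> \<theta>" using meet_assoc[OF z(1) xy] by simp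
    then show "p x \<sqinter>\<^bsub>?Q\<^esub> p y \<sqsubseteq>\<^bsub>?Q\<^esub> p (x \<sqinter> y)" using Q_le[OF z(1) xyc] z(2) by simp
  qed
  have "frame ?Q"
  proof
    fix X S assume X: "X \<in> carrier ?Q" and S: "S \<subseteq> carrier ?Q"
    obtain x where x: "x \<in> carrier L" "X = p x" using X unfolding Q_carrier by blast
    obtain A where A: "A \<subseteq> carrier L" "S = p ` A" using lift[OF S] by blast
    have sA: "\<Squnion>A \<in> carrier L" using A by simp
    have xA: "(\<lambda>a. x \<sqinter> a) ` A \<subseteq> carrier L"
      by (intro image_subsetI meet_closed x(1) subsetD[OF A(1)])
    have "X \<sqinter>\<^bsub>?Q\<^esub> (\<Squnion>\<^bsub>?Q\<^esub> S) = p (x \<sqinter> \<Squnion>A)"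
      by (simp only: x(2) A(2) p_meet[OF x(1) sA] p_sup[OF A(1)])
    also have "\<dots> = \<Squnion>\<^bsub>?Q\<^esub> (p ` (\<lambda>a. x \<sqinter> a) ` A)"
      by (simp only: meet_sup_distrib[OF x(1) A(1)] p_sup[OF xA])
    also have "p ` (\<lambda>a. x \<sqinter> a) ` A = (\<lambda>s. X \<sqinter>\<^bsub>?Q\<^esub> s) ` S"
      unfolding A(2) x(2) image_image
      by (rule image_cong[OF HOL.refl p_meet[OF x(1) subsetD[OF A(1)]]])
    finally show "X \<sqinter>\<^bsub>?Q\<^esub> (\<Squnion>\<^bsub>?Q\<^esub> S) = \<Squnion>\<^bsub>?Q\<^esub> ((\<lambda>s. X \<sqinter>\<^bsub>?Q\<^esub> s) ` S)" .
  qed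
  moreover have "p \<top> = \<top>\<^bsub>?Q\<^esub>"
  proof (rule Q.le_antisym)
    show "p \<top> \<in> carrier ?Q" "\<top>\<^bsub>?Q\<^esub> \<in> carrier ?Q" using p_closed by simp_all
    then show "p \<top> \<sqsubseteq>\<^bsub>?Q\<^esub> \<top>\<^bsub>?Q\<^esub>" by (simp add: Q.top_higher)
    obtain z where z: "z \<in> carrier L" "\<top>\<^bsub>?Q\<^esub> = p z"
      using Q.top_closed Q_carrier by blast
    show "\<top>\<^bsub>?Q\<^esub> \<sqsubseteq>\<^bsub>?Q\<^esub> p \<top>"
      unfolding z(2) by (rule le[OF top_higher[OF z(1)] z(1) top_closed])
  qed
  ultimately have "frame_hom L ?Q p"
    unfolding frame_hom_def using L p_closed p_meet p_sup by simp
  then show ?thesis by (simp add: p_def[abs_def])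
qed

declare free_frame_simps(1) [simp del]

end

theory Submission
  imports Defs
begin

text \<open>
  A countably presented frame has a countable base, namely the finite meets of generators. In a
  countably presented product each nontrivial coordinate \<open>i\<close> gives an element \<open>e\<^sub>i\<close> that is top at \<open>i\<close>
  and bottom elsewhere; these are nonzero and pairwise disjoint, so they lie above distinct base
  elements.

  Conversely, a countable product of nontrivial frames \<open>L i\<close> is presented by the generators of all
  the \<open>L i\<close> together with elements \<open>e\<^sub>i\<close>, subject to: the \<open>e\<^sub>i\<close> are pairwise disjoint and cover the
  top, the generators of \<open>L i\<close> lie below \<open>e\<^sub>i\<close>, and the relations of \<open>L i\<close> hold below \<open>e\<^sub>i\<close>. Modulo
  these relations an element \<open>U\<close> is the join of the \<open>e\<^sub>i \<and> U\<close>, and \<open>e\<^sub>i \<and> U\<close> depends only on the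
  projection of \<open>U\<close> to the free frame of \<open>L i\<close>.
\<close>

section \<open>Frame homomorphisms\<close>

context frame
begin

lemma sup_empty: "\<Squnion>{} = \<bottom>"
  using weak_sup_empty by (simp add: eq_is_equal)

lemma meet_bottom: "x \<in> carrier L \<Longrightarrow> x \<sqinter> \<bottom> = \<bottom>"
  by (meson bottom_closed bottom_lower le_antisym meet_closed meet_right)

end

lemma trivial_frame_iff:
  assumes "frame L"
  shows "trivial_frame L \<longleftrightarrow> \<bottom>\<^bsub>L\<^esub> = \<top>\<^bsub>L\<^esub>"
proof -
  interpret frame L by (rule assms)
  have "x = \<top>\<^bsub>L\<^esub>" if "\<bottom>\<^bsub>L\<^esub> = \<top>\<^bsub>L\<^esub>" "x \<in> carrier L" for x
    using that bottom_lower[OF that(2)] top_higher[OF that(2)] by (simp add: le_antisym)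
  then show ?thesis unfolding trivial_frame_def by (metis top_closed bottom_closed)
qed

lemma frame_hom_frames:
  assumes "frame_hom L M f"
  shows "frame L" "frame M"
  using assms by (simp_all add: frame_hom_def)

lemma frame_hom_closed:
  assumes "frame_hom L M f" "x \<in> carrier L"
  shows "f x \<in> carrier M"
  using assms by (auto simp: frame_hom_def)

lemma frame_hom_image:
  assumes "frame_hom L M f" "S \<subseteq> carrier L"
  shows "f ` S \<subseteq> carrier M"
  using frame_hom_closed[OF assms(1)] assms(2) by auto

lemma frame_hom_bottom:
  assumes "frame_hom L M f"
  shows "f \<bottom>\<^bsub>L\<^esub> = \<bottom>\<^bsub>M\<^esub>"
  using frame_homD(3)[OF assms, of "{}"] frame_hom_frames[OF assms]
  by (simp add: frame.sup_empty)

lemma frame_hom_id: "frame L \<Longrightarrow> frame_hom L L (\<lambda>x. x)"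
  by (simp add: frame_hom_def)

lemma frame_hom_comp:
  assumes "frame_hom L M f" "frame_hom M N g"
  shows "frame_hom L N (\<lambda>x. g (f x))"
proof -
  have "g (f (\<Squnion>\<^bsub>L\<^esub> S)) = \<Squnion>\<^bsub>N\<^esub> ((\<lambda>x. g (f x)) ` S)" if "S \<subseteq> carrier L" for S
    using frame_homD(3)[OF assms(1) that] frame_homD(3)[OF assms(2) frame_hom_image[OF assms(1) that]]
    by (simp add: image_image)
  then show ?thesis
    using frame_hom_frames[OF assms(1)] frame_hom_frames[OF assms(2)]
      frame_homD(1,2)[OF assms(1)] frame_homD(1,2)[OF assms(2)]
      frame_hom_closed[OF assms(1)] frame_hom_closed[OF assms(2)]
    by (simp add: frame_hom_def)
qed

text \<open>Factoring through a surjection: elements and subsets of \<open>M\<close> lift to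
  \<open>F\<close> along \<open>h\<close>, and there the preservation laws of \<open>f\<close> are
  those of \<open>p\<close>.\<close>

lemma frame_hom_factor:
  assumes p: "frame_hom F Q p" and h: "frame_hom F M h" and surj: "h ` carrier F = carrier M"
    and f: "\<And>x. x \<in> carrier F \<Longrightarrow> f (h x) = p x"
  shows "frame_hom M Q f"
proof -
  interpret F: frame F using frame_hom_frames[OF p] by simp
  have "f \<in> carrier M \<rightarrow> carrier Q"
    using f frame_hom_closed[OF p] unfolding surj[symmetric] by auto
  moreover have "f \<top>\<^bsub>M\<^esub> = \<top>\<^bsub>Q\<^esub>"
    using f[OF F.top_closed] frame_homD(1)[OF p] frame_homD(1)[OF h] by simp
  moreover have "f (x \<sqinter>\<^bsub>M\<^esub> y) = f x \<sqinter>\<^bsub>Q\<^esub> f y" if xyM: "x \<in> carrier M" "y \<in> carrier M" for x y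
  proof -
    obtain u v where uv: "u \<in> carrier F" "v \<in> carrier F" and xy: "x = h u" "y = h v"
      using xyM unfolding surj[symmetric] by blast
    show ?thesis
      unfolding xy frame_homD(2)[OF h uv, symmetric]
      using frame_homD(2)[OF p uv] f uv by simp
  qed
  moreover have "f (\<Squnion>\<^bsub>M\<^esub> S) = \<Squnion>\<^bsub>Q\<^esub> (f ` S)" if "S \<subseteq> carrier M" for S
  proof -
    obtain T where T: "T \<subseteq> carrier F" "S = h ` T"
      using \<open>S \<subseteq> carrier M\<close> unfolding surj[symmetric] subset_image_iff by blast
    have "f ` S = p ` T" unfolding T(2) image_image using f T(1) by (intro image_cong) auto
    then show ?thesis
      using frame_homD(3)[OF h T(1)] frame_homD(3)[OF p T(1)] f[OF F.sup_closed[OF T(1)]] T(2)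
      by simp
  qed
  ultimately show ?thesis
    using frame_hom_frames[OF p] frame_hom_frames[OF h] by (simp add: frame_hom_def)
qed

section \<open>Frame congruences\<close>

context
  fixes L :: "'a gorder" (structure) and \<theta>
  assumes \<theta>: "frame_congruence L \<theta>"
begin

lemma frame_congruence_refl: "x \<in> carrier L \<Longrightarrow> (x, x) \<in> \<theta>"
  using \<theta> by (simp add: frame_congruence_def equiv_def refl_on_def)

lemma frame_congruence_sym: "(x, y) \<in> \<theta> \<Longrightarrow> (y, x) \<in> \<theta>"
  using \<theta> by (simp add: frame_congruence_def equiv_def symD)

lemma frame_congruence_trans: "\<lbrakk>(x, y) \<in> \<theta>; (y, z) \<in> \<theta>\<rbrakk> \<Longrightarrow> (x, z) \<in> \<theta>"
  using \<theta> unfolding frame_congruence_def equiv_def by (blast dest: transD)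

lemma frame_congruence_closed: "(x, y) \<in> \<theta> \<Longrightarrow> x \<in> carrier L \<and> y \<in> carrier L"
  using \<theta> by (auto simp: frame_congruence_def equiv_def)

lemma frame_congruence_meet: "\<lbrakk>(a, b) \<in> \<theta>; (c, d) \<in> \<theta>\<rbrakk> \<Longrightarrow> (a \<sqinter> c, b \<sqinter> d) \<in> \<theta>"
  using \<theta> unfolding frame_congruence_def by blast

lemma frame_congruence_sup:
  assumes "\<And>i. i \<in> K \<Longrightarrow> (f i, g i) \<in> \<theta>"
  shows "(\<Squnion>(f ` K), \<Squnion>(g ` K)) \<in> \<theta>"
proof -
  have "(\<lambda>i. (f i, g i)) ` K \<subseteq> \<theta>" using assms by (intro image_subsetI)
  then have "(\<Squnion>(fst ` (\<lambda>i. (f i, g i)) ` K), \<Squnion>(snd ` (\<lambda>i. (f i, g i)) ` K)) \<in> \<theta>"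
    using \<theta> unfolding frame_congruence_def by blast
  then show ?thesis by (simp only: image_image fst_conv snd_conv)
qed

end

text \<open>A congruence is closed under binary meets and arbitrary joins, so it pulls back along
  maps preserving these. This covers \<open>A \<mapsto> E i \<inter> incl i A\<close>, which sends
  the top to \<open>E i\<close>, as well as frame homomorphisms.\<close>

lemma frame_congruence_pullback:
  assumes L: "frame L" and \<theta>: "frame_congruence M \<theta>"
    and closed: "\<And>x. x \<in> carrier L \<Longrightarrow> f x \<in> carrier M"
    and meet: "\<And>x y. \<lbrakk>x \<in> carrier L; y \<in> carrier L\<rbrakk> \<Longrightarrow> f (x \<sqinter>\<^bsub>L\<^esub> y) = f x \<sqinter>\<^bsub>M\<^esub> f y"
    and sup: "\<And>S. S \<subseteq> carrier L \<Longrightarrow> f (\<Squnion>\<^bsub>L\<^esub> S) = \<Squnion>\<^bsub>M\<^esub> (f ` S)"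
  shows "frame_congruence L {(x, y) \<in> carrier L \<times> carrier L. (f x, f y) \<in> \<theta>}" (is "frame_congruence L ?K")
proof -
  interpret frame L by (rule L)
  have "equiv (carrier L) ?K"
  proof (rule equivI)
    show "?K \<subseteq> carrier L \<times> carrier L" by auto
    show "refl_on (carrier L) ?K"
      using closed frame_congruence_refl[OF \<theta>] by (auto simp: refl_on_def)
    show "sym ?K" using frame_congruence_sym[OF \<theta>] by (auto intro: symI)
    show "trans ?K" using frame_congruence_trans[OF \<theta>] by (blast intro: transI)
  qed
  moreover have "(a \<sqinter>\<^bsub>L\<^esub> c, b \<sqinter>\<^bsub>L\<^esub> d) \<in> ?K" if "(a, b) \<in> ?K" "(c, d) \<in> ?K" for a b c d
    using that meet frame_congruence_meet[OF \<theta>] by auto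
  moreover have "(\<Squnion>\<^bsub>L\<^esub> (fst ` P), \<Squnion>\<^bsub>L\<^esub> (snd ` P)) \<in> ?K" if P: "P \<subseteq> ?K" for P
  proof -
    have c: "fst ` P \<subseteq> carrier L" "snd ` P \<subseteq> carrier L" using P by auto
    have "(\<Squnion>\<^bsub>M\<^esub> ((\<lambda>z. f (fst z)) ` P), \<Squnion>\<^bsub>M\<^esub> ((\<lambda>z. f (snd z)) ` P)) \<in> \<theta>"
      by (rule frame_congruence_sup[OF \<theta>]) (use P in auto)
    then show ?thesis using sup[OF c(1)] sup[OF c(2)] c by (simp add: image_image)
  qed
  ultimately show ?thesis unfolding frame_congruence_def by blast
qed

lemma frame_congruence_Id_on:
  assumes "frame L"
  shows "frame_congruence L (Id_on (carrier L))"
proof -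
  interpret frame L by (rule assms)
  have "(\<Squnion>\<^bsub>L\<^esub> (fst ` P), \<Squnion>\<^bsub>L\<^esub> (snd ` P)) \<in> Id_on (carrier L)" if P: "P \<subseteq> Id_on (carrier L)" for P
  proof -
    have "fst ` P = snd ` P" "fst ` P \<subseteq> carrier L"
      using P by (auto intro!: image_cong)
    then show ?thesis by (simp add: Id_on_def)
  qed
  then show ?thesis
    by (auto simp: frame_congruence_def equiv_def refl_on_def sym_def trans_def)
qed

text \<open>The kernel is the pullback of the diagonal congruence.\<close>

lemma frame_congruence_kernel:
  assumes "frame_hom L M h"
  shows "frame_congruence L {(x, y) \<in> carrier L \<times> carrier L. h x = h y}"
proof -
  have "{(x, y) \<in> carrier L \<times> carrier L. h x = h y}
      = {(x, y) \<in> carrier L \<times> carrier L. (h x, h y) \<in> Id_on (carrier M)}"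
    using frame_hom_closed[OF assms] by auto
  then show ?thesis
    using frame_congruence_pullback[OF frame_hom_frames(1)[OF assms]
        frame_congruence_Id_on[OF frame_hom_frames(2)[OF assms]]
        frame_hom_closed[OF assms] frame_homD(2,3)[OF assms]] by simp
qed

section \<open>Generated congruences, quotients, and presentations as surjections\<close>

lemma generated_congruence_least:
  "\<lbrakk>frame_congruence L \<theta>; R \<subseteq> \<theta>\<rbrakk> \<Longrightarrow> generated_congruence L R \<subseteq> \<theta>"
  by (auto simp: generated_congruence_def)

text \<open>This is the first isomorphism theorem. It trades equivalence classes for a surjection
  with a prescribed kernel, the form in which presentations are used from here on.\<close>

lemma frame_isomorphic_quotient_iff:
  assumes F: "frame F" and \<theta>: "frame_congruence F \<theta>" and L: "frame L"
  shows "frame_isomorphic L (quotient_frame F \<theta>) \<longleftrightarrow>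
    (\<exists>h. frame_hom F L h \<and> h ` carrier F = carrier L \<and>
      (\<forall>x\<in>carrier F. \<forall>y\<in>carrier F. h x = h y \<longleftrightarrow> (x, y) \<in> \<theta>))"
proof
  let ?Q = "quotient_frame F \<theta>" and ?p = "\<lambda>x. \<theta> `` {x}"
  have p: "frame_hom F ?Q ?p" by (rule quotient_frame_projection[OF F \<theta>])
  have eqv: "equiv (carrier F) \<theta>" using \<theta> by (simp add: frame_congruence_def)
  have p_surj: "?p ` carrier F = carrier ?Q" by (auto simp: quotient_frame_def quotient_def)
  have p_eq: "?p x = ?p y \<longleftrightarrow> (x, y) \<in> \<theta>" if "x \<in> carrier F" "y \<in> carrier F" for x y
    by (rule eq_equiv_class_iff[OF eqv that])
  {
    assume "frame_isomorphic L ?Q"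
    then obtain f where f: "frame_hom L ?Q f" and bij: "bij_betw f (carrier L) (carrier ?Q)"
      unfolding frame_isomorphic_def by blast
    let ?g = "inv_into (carrier L) f"
    \<comment> \<open>The inverse of a bijective homomorphism is a homomorphism, because the
      identity of \<open>L\<close> factors through \<open>f\<close>.\<close>
    have "frame_hom ?Q L ?g"
      by (rule frame_hom_factor[OF frame_hom_id[OF L] f])
        (use bij in \<open>auto simp: bij_betw_def\<close>)
    from frame_hom_comp[OF p this] have "frame_hom F L (\<lambda>x. ?g (?p x))" .
    moreover have bij': "bij_betw ?g (carrier ?Q) (carrier L)" using bij by (rule bij_betw_inv_into)
    then have "(\<lambda>x. ?g (?p x)) ` carrier F = carrier L"
      using p_surj by (metis bij_betw_def image_image)
    moreover have "?g (?p x) = ?g (?p y) \<longleftrightarrow> (x, y) \<in> \<theta>" if "x \<in> carrier F" "y \<in> carrier F" for x y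
      using bij' p_eq[OF that] frame_hom_closed[OF p that(1)] frame_hom_closed[OF p that(2)]
      by (metis bij_betw_def inj_on_eq_iff)
    ultimately show "\<exists>h. frame_hom F L h \<and> h ` carrier F = carrier L \<and>
      (\<forall>x\<in>carrier F. \<forall>y\<in>carrier F. h x = h y \<longleftrightarrow> (x, y) \<in> \<theta>)" by blast
  }
  assume "\<exists>h. frame_hom F L h \<and> h ` carrier F = carrier L \<and>
      (\<forall>x\<in>carrier F. \<forall>y\<in>carrier F. h x = h y \<longleftrightarrow> (x, y) \<in> \<theta>)"
  then obtain h where h: "frame_hom F L h" and surj: "h ` carrier F = carrier L"
    and ker: "\<And>x y. \<lbrakk>x \<in> carrier F; y \<in> carrier F\<rbrakk> \<Longrightarrow> h x = h y \<longleftrightarrow> (x, y) \<in> \<theta>"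
    by (elim exE conjE) metis
  \<comment> \<open>An arbitrary preimage under \<open>h\<close> will do: two preimages of the same
    element are related by \<open>\<theta>\<close> and so have the same class.\<close>
  define f where "f x = ?p (inv_into (carrier F) h x)" for x
  have f: "f (h x) = ?p x" if x: "x \<in> carrier F" for x
  proof -
    have "inv_into (carrier F) h (h x) \<in> carrier F" "h (inv_into (carrier F) h (h x)) = h x"
      using x by (auto intro: inv_into_into f_inv_into_f)
    then show ?thesis unfolding f_def using ker p_eq x by simp
  qed
  have "f ` carrier L = carrier ?Q"
    using p_surj f unfolding surj[symmetric] image_image by simp
  moreover have "inj_on f (carrier L)"
    unfolding surj[symmetric] using f ker p_eq by (intro inj_onI) auto
  ultimately show "frame_isomorphic L ?Q"
    using frame_hom_factor[OF p h surj f] unfolding frame_isomorphic_def bij_betw_def by blast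
qed

text \<open>The previous equivalence applied to free frames; that \<open>L\<close> is a frame is
  absorbed into \<open>frame_hom\<close>.\<close>

lemma countably_presented_iff:
  "countably_presented L \<longleftrightarrow>
    (\<exists>(G :: nat set) R h. countable R \<and> R \<subseteq> carrier (free_frame G) \<times> carrier (free_frame G) \<and>
      frame_hom (free_frame G) L h \<and> h ` carrier (free_frame G) = carrier L \<and>
      (\<forall>U\<in>carrier (free_frame G). \<forall>V\<in>carrier (free_frame G).
         h U = h V \<longleftrightarrow> (U, V) \<in> generated_congruence (free_frame G) R))"
    (is "_ \<longleftrightarrow> (\<exists>G R h. countable R \<and> ?sub G R \<and> ?pres G R h)")
proof -
  have "frame_isomorphic L (quotient_frame (free_frame G) (generated_congruence (free_frame G) R)) \<longleftrightarrow>
      (\<exists>h. ?pres G R h)" if "frame L" "?sub G R" for G :: "nat set" and R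
    using frame_isomorphic_quotient_iff[OF free_frame_frame
        generated_congruence(1)[OF free_frame_frame that(2)] that(1)] .
  then have eq: "frame L \<longrightarrow> ?sub G R \<longrightarrow>
      frame_isomorphic L (quotient_frame (free_frame G) (generated_congruence (free_frame G) R)) \<longleftrightarrow>
      (\<exists>h. ?pres G R h)" for G :: "nat set" and R
    by (intro impI)
  have frL: "(\<exists>h. ?pres G R h) \<longrightarrow> frame L" for G :: "nat set" and R
    by (intro impI) (elim exE conjE, rule frame_hom_frames(2))
  have *: "frame L \<and> countable R \<and> ?sub G R \<and>
      frame_isomorphic L (quotient_frame (free_frame G) (generated_congruence (free_frame G) R)) \<longleftrightarrow>
      countable R \<and> ?sub G R \<and> (\<exists>h. ?pres G R h)" for G :: "nat set" and R
    using eq[of R G] frL[of G R] by argo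
  have "countably_presented L \<longleftrightarrow> (\<exists>(G :: nat set) R. frame L \<and> countable R \<and> ?sub G R \<and>
      frame_isomorphic L (quotient_frame (free_frame G) (generated_congruence (free_frame G) R)))"
    unfolding countably_presented_def by (simp only: ex_simps)
  also have "\<dots> \<longleftrightarrow> (\<exists>G R h. countable R \<and> ?sub G R \<and> ?pres G R h)"
    unfolding * by (simp only: ex_simps)
  finally show ?thesis .
qed

section \<open>Free frames\<close>

text \<open>For finite \<open>A \<subseteq> G\<close> this principal upset is the formal meet of the
  generators in \<open>A\<close>. These elements form a base of the free frame.\<close>

definition free_basic :: "'g set \<Rightarrow> 'g set \<Rightarrow> 'g set set" where
  "free_basic G A = {B \<in> Fpow G. A \<subseteq> B}"

lemma free_basic_closed: "free_basic G A \<in> carrier (free_frame G)"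
  by (auto simp: free_basic_def free_frame_simps)

lemma free_basic_empty: "free_basic G {} = Fpow G"
  by (simp add: free_basic_def)

lemma free_basic_insert: "free_basic G (insert g A) = free_gen G g \<inter> free_basic G A"
  by (auto simp: free_basic_def free_gen_def)

lemma free_frame_UN_basic:
  assumes "U \<in> carrier (free_frame G)"
  shows "(\<Union>A\<in>U. free_basic G A) = U"
  using free_frame_carrierD[OF assms] by (auto simp: free_basic_def)

lemma free_frame_Int_closed:
  assumes "U \<in> carrier (free_frame G)" "V \<in> carrier (free_frame G)"
  shows "U \<inter> V \<in> carrier (free_frame G)"
  using assms by (auto simp: free_frame_simps)

lemma free_frame_Fpow_closed: "Fpow G \<in> carrier (free_frame G)"
  by (simp add: free_frame_simps)

lemma free_frame_empty_closed: "{} \<in> carrier (free_frame G)"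
  by (simp add: free_frame_simps)

lemma free_frame_bottom: "\<bottom>\<^bsub>free_frame G\<^esub> = {}"
  by (simp add: frame.sup_empty[OF free_frame_frame, symmetric] free_frame_sup)

text \<open>Finite meets of generators are reached from the top by adding one generator at a time,
  and every element is a join of such meets.\<close>

lemma free_frame_induct [consumes 1, case_names gen top meet sup]:
  assumes U: "U \<in> carrier (free_frame G)"
    and gen: "\<And>g. g \<in> G \<Longrightarrow> P (free_gen G g)"
    and top: "P (Fpow G)"
    and meet: "\<And>U V. \<lbrakk>U \<in> carrier (free_frame G); V \<in> carrier (free_frame G); P U; P V\<rbrakk> \<Longrightarrow> P (U \<inter> V)"
    and sup: "\<And>S. \<lbrakk>S \<subseteq> carrier (free_frame G); \<And>U. U \<in> S \<Longrightarrow> P U\<rbrakk> \<Longrightarrow> P (\<Union>S)"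
  shows "P U"
proof -
  have basic: "P (free_basic G A)" if "finite A" "A \<subseteq> G" for A
    using that
    by (induction A)
      (simp_all add: free_basic_empty free_basic_insert top gen meet free_gen_closed free_basic_closed)
  have "P (\<Union>(free_basic G ` U))"
  proof (rule sup)
    show "free_basic G ` U \<subseteq> carrier (free_frame G)" using free_basic_closed by blast
    show "P V" if "V \<in> free_basic G ` U" for V
      using that basic free_frame_carrierD(1)[OF U] by (auto simp: Fpow_def)
  qed
  then show ?thesis using free_frame_UN_basic[OF U] by simp
qed

lemma free_frame_homD:
  assumes h: "frame_hom (free_frame G) M h"
  shows "h (Fpow G) = \<top>\<^bsub>M\<^esub>" "h {} = \<bottom>\<^bsub>M\<^esub>"
    and "\<lbrakk>U \<in> carrier (free_frame G); V \<in> carrier (free_frame G)\<rbrakk> \<Longrightarrow> h (U \<inter> V) = h U \<sqinter>\<^bsub>M\<^esub> h V"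
    and "S \<subseteq> carrier (free_frame G) \<Longrightarrow> h (\<Union>S) = \<Squnion>\<^bsub>M\<^esub> (h ` S)"
  using frame_homD[OF h] frame_hom_bottom[OF h]
  by (simp_all add: free_frame_top free_frame_bottom free_frame_meet free_frame_sup)

lemma free_frame_endo_homD:
  assumes h: "frame_hom (free_frame G) (free_frame H) h"
  shows "h (Fpow G) = Fpow H" "h {} = {}"
    and "\<lbrakk>U \<in> carrier (free_frame G); V \<in> carrier (free_frame G)\<rbrakk> \<Longrightarrow> h (U \<inter> V) = h U \<inter> h V"
    and "S \<subseteq> carrier (free_frame G) \<Longrightarrow> h (\<Union>S) = \<Union>(h ` S)"
  using free_frame_homD[OF h] frame_hom_closed[OF h] frame_hom_image[OF h]
  by (simp_all add: free_frame_top free_frame_bottom free_frame_meet free_frame_sup)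

lemma free_congruence_Int:
  assumes \<theta>: "frame_congruence (free_frame G) \<theta>" and "(U, V) \<in> \<theta>" "(U', V') \<in> \<theta>"
  shows "(U \<inter> U', V \<inter> V') \<in> \<theta>"
  using frame_congruence_meet[OF assms] frame_congruence_closed[OF \<theta> assms(2)]
    frame_congruence_closed[OF \<theta> assms(3)] by (simp add: free_frame_meet)

lemma free_congruence_UN:
  assumes \<theta>: "frame_congruence (free_frame G) \<theta>" and fg: "\<And>i. i \<in> K \<Longrightarrow> (f i, g i) \<in> \<theta>"
  shows "(\<Union>i\<in>K. f i, \<Union>i\<in>K. g i) \<in> \<theta>"
proof -
  have "f ` K \<subseteq> carrier (free_frame G)" "g ` K \<subseteq> carrier (free_frame G)"
    using frame_congruence_closed[OF \<theta> fg] by blast+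
  then show ?thesis using frame_congruence_sup[OF \<theta>, of K f g] fg by (simp add: free_frame_sup)
qed

text \<open>The images under \<open>h\<close> of the finite meets of generators form a countable
  base. Each \<open>e i\<close> dominates a nonzero member of it, and one nonzero member cannot lie
  below two disjoint elements.\<close>

lemma countably_presented_disjoint_countable:
  assumes L: "countably_presented L"
    and e: "\<And>i. i \<in> J \<Longrightarrow> e i \<in> carrier L" "\<And>i. i \<in> J \<Longrightarrow> e i \<noteq> \<bottom>\<^bsub>L\<^esub>"
    and disj: "\<And>i j. \<lbrakk>i \<in> J; j \<in> J; i \<noteq> j\<rbrakk> \<Longrightarrow> e i \<sqinter>\<^bsub>L\<^esub> e j = \<bottom>\<^bsub>L\<^esub>"
  shows "countable J"
proof -
  obtain G :: "nat set" and h where h: "frame_hom (free_frame G) L h"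
    and surj: "h ` carrier (free_frame G) = carrier L"
    using L unfolding countably_presented_iff by (elim exE conjE) (rule that)
  interpret frame L using frame_hom_frames[OF h] by simp
  have hb: "h (free_basic G A) \<in> carrier L" for A
    using frame_hom_closed[OF h free_basic_closed] .
  have "\<exists>A. A \<in> Fpow G \<and> h (free_basic G A) \<sqsubseteq>\<^bsub>L\<^esub> e i \<and> h (free_basic G A) \<noteq> \<bottom>\<^bsub>L\<^esub>"
    if i: "i \<in> J" for i
  proof -
    obtain U where U: "U \<in> carrier (free_frame G)" "h U = e i" using e(1)[OF i] surj by (metis imageE)
    have "free_basic G ` U \<subseteq> carrier (free_frame G)" using free_basic_closed by blast
    \<comment> \<open>Decomposing a preimage \<open>U\<close> of \<open>e i\<close> into basic
      elements and applying \<open>h\<close> writes \<open>e i\<close> as a join of base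
      elements.\<close>
    from free_frame_homD(4)[OF h this] have sup: "e i = \<Squnion>\<^bsub>L\<^esub> ((\<lambda>A. h (free_basic G A)) ` U)"
      using U free_frame_UN_basic[OF U(1)] by (simp add: image_image)
    have c: "(\<lambda>A. h (free_basic G A)) ` U \<subseteq> carrier L" using hb by blast
    \<comment> \<open>A join of bottoms is bottom, whereas \<open>e i\<close> is not.\<close>
    have "\<exists>A\<in>U. h (free_basic G A) \<noteq> \<bottom>\<^bsub>L\<^esub>"
    proof (rule ccontr)
      assume "\<not> ?thesis"
      then have "e i \<sqsubseteq>\<^bsub>L\<^esub> \<bottom>\<^bsub>L\<^esub>" unfolding sup by (intro sup_least[OF c]) auto
      then show False using e[OF i] by (meson bottom_closed bottom_lower le_antisym)
    qed
    then obtain A where "A \<in> U" "h (free_basic G A) \<noteq> \<bottom>\<^bsub>L\<^esub>" by blast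
    then show ?thesis
      using sup_upper[OF c] free_frame_carrierD(1)[OF U(1)] unfolding sup by blast
  qed
  then obtain b where b: "\<And>i. i \<in> J \<Longrightarrow> b i \<in> Fpow G"
    and b_le: "\<And>i. i \<in> J \<Longrightarrow> h (free_basic G (b i)) \<sqsubseteq>\<^bsub>L\<^esub> e i"
    and b_ne: "\<And>i. i \<in> J \<Longrightarrow> h (free_basic G (b i)) \<noteq> \<bottom>\<^bsub>L\<^esub>" by metis
  have "inj_on b J"
  proof (rule inj_onI, rule ccontr)
    fix i j assume ij: "i \<in> J" "j \<in> J" "b i = b j" "i \<noteq> j"
    have "h (free_basic G (b i)) \<sqsubseteq>\<^bsub>L\<^esub> e i \<sqinter>\<^bsub>L\<^esub> e j"
      using b_le[OF ij(1)] b_le[OF ij(2)] ij(3) e(1) ij hb by (intro meet_le) simp_all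
    then show False
      using disj[OF ij(1,2,4)] b_ne[OF ij(1)] hb by (metis bottom_closed bottom_lower le_antisym)
  qed
  \<comment> \<open>The values of \<open>b\<close> are finite sets of natural numbers.\<close>
  moreover have "countable (b ` J)"
  proof (rule countable_subset)
    show "b ` J \<subseteq> {A. finite A \<and> A \<subseteq> G}" using b by (auto simp: Fpow_def)
    show "countable {A. finite A \<and> A \<subseteq> G}" by (rule countable_Collect_finite_subset) simp
  qed
  ultimately show ?thesis by (rule countable_image_inj_on[rotated])
qed

section \<open>Products of frames\<close>

lemma product_frame_simps:
  "carrier (product_frame I L) = (\<Pi>\<^sub>E i\<in>I. carrier (L i))"
  "le (product_frame I L) x y \<longleftrightarrow> (\<forall>i\<in>I. x i \<sqsubseteq>\<^bsub>L i\<^esub> y i)"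
  "eq (product_frame I L) = (=)"
  by (simp_all add: product_frame_def)

context
  fixes I :: "'i set" and L :: "'i \<Rightarrow> 'a gorder"
  assumes L: "\<And>i. i \<in> I \<Longrightarrow> frame (L i)"
begin

private abbreviation (input) "P \<equiv> product_frame I L"

lemma product_frame_partial_order: "partial_order P"
proof
  show "x \<sqsubseteq>\<^bsub>P\<^esub> x" if "x \<in> carrier P" for x
  proof -
    have "x i \<sqsubseteq>\<^bsub>L i\<^esub> x i" if i: "i \<in> I" for i
    proof -
      interpret frame "L i" by (rule L[OF i])
      show ?thesis using \<open>x \<in> carrier P\<close> i by (auto simp: product_frame_simps)
    qed
    then show ?thesis by (simp add: product_frame_simps)
  qed
  show "x .=\<^bsub>P\<^esub> y" if "x \<sqsubseteq>\<^bsub>P\<^esub> y" "y \<sqsubseteq>\<^bsub>P\<^esub> x" "x \<in> carrier P" "y \<in> carrier P" for x y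
  proof -
    have "x i = y i" if i: "i \<in> I" for i
    proof -
      interpret frame "L i" by (rule L[OF i])
      show ?thesis
        by (rule le_antisym)
          (use \<open>x \<sqsubseteq>\<^bsub>P\<^esub> y\<close> \<open>y \<sqsubseteq>\<^bsub>P\<^esub> x\<close> \<open>x \<in> carrier P\<close> \<open>y \<in> carrier P\<close> i in
            \<open>auto simp: product_frame_simps\<close>)
    qed
    then have "x = y" using that(3,4) by (auto simp: product_frame_simps intro: PiE_ext)
    then show ?thesis by (simp add: product_frame_simps)
  qed
  show "x \<sqsubseteq>\<^bsub>P\<^esub> z"
    if "x \<sqsubseteq>\<^bsub>P\<^esub> y" "y \<sqsubseteq>\<^bsub>P\<^esub> z" "x \<in> carrier P" "y \<in> carrier P" "z \<in> carrier P" for x y z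
  proof -
    have "x i \<sqsubseteq>\<^bsub>L i\<^esub> z i" if i: "i \<in> I" for i
    proof -
      interpret frame "L i" by (rule L[OF i])
      show ?thesis
        by (rule le_trans[of _ "y i"])
          (use \<open>x \<sqsubseteq>\<^bsub>P\<^esub> y\<close> \<open>y \<sqsubseteq>\<^bsub>P\<^esub> z\<close> \<open>x \<in> carrier P\<close> \<open>y \<in> carrier P\<close> \<open>z \<in> carrier P\<close> i in
            \<open>auto simp: product_frame_simps\<close>)
    qed
    then show ?thesis by (simp add: product_frame_simps)
  qed
qed (simp_all add: product_frame_simps)

text \<open>Joins are taken coordinatewise; the restriction to \<open>I\<close> keeps the function
  extensional, as the carrier demands.\<close>

lemma product_frame_lub:
  assumes S: "S \<subseteq> carrier P"
  shows "least P (\<lambda>i\<in>I. \<Squnion>\<^bsub>L i\<^esub> ((\<lambda>x. x i) ` S)) (Upper P S)" (is "least P ?s _")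
proof (rule least_UpperI[OF _ _ S])
  have c: "(\<lambda>x. x i) ` S \<subseteq> carrier (L i)" if "i \<in> I" for i
    using that S by (auto simp: product_frame_simps)
  have cl: "\<Squnion>\<^bsub>L i\<^esub> A \<in> carrier (L i)" "x \<in> A \<Longrightarrow> x \<sqsubseteq>\<^bsub>L i\<^esub> \<Squnion>\<^bsub>L i\<^esub> A"
    "\<lbrakk>y \<in> carrier (L i); \<And>x. x \<in> A \<Longrightarrow> x \<sqsubseteq>\<^bsub>L i\<^esub> y\<rbrakk> \<Longrightarrow> \<Squnion>\<^bsub>L i\<^esub> A \<sqsubseteq>\<^bsub>L i\<^esub> y"
    if "i \<in> I" "A \<subseteq> carrier (L i)" for i A x y
  proof -
    interpret frame "L i" by (rule L[OF that(1)])
    show "\<Squnion>\<^bsub>L i\<^esub> A \<in> carrier (L i)" using that(2) by simp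
    show "x \<in> A \<Longrightarrow> x \<sqsubseteq>\<^bsub>L i\<^esub> \<Squnion>\<^bsub>L i\<^esub> A" using that(2) by (rule sup_upper)
    show "\<lbrakk>y \<in> carrier (L i); \<And>x. x \<in> A \<Longrightarrow> x \<sqsubseteq>\<^bsub>L i\<^esub> y\<rbrakk> \<Longrightarrow> \<Squnion>\<^bsub>L i\<^esub> A \<sqsubseteq>\<^bsub>L i\<^esub> y"
      using that(2) by (intro sup_least)
  qed
  show "?s \<in> carrier P" using cl(1)[OF _ c] by (simp add: product_frame_simps)
  show "x \<sqsubseteq>\<^bsub>P\<^esub> ?s" if "x \<in> S" for x
    using that cl(2)[OF _ c] by (auto simp: product_frame_simps)
  show "?s \<sqsubseteq>\<^bsub>P\<^esub> y" if y: "y \<in> Upper P S" for y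
  proof -
    have "y \<in> carrier P" using y subsetD[OF Upper_closed] by metis
    moreover have "x \<sqsubseteq>\<^bsub>P\<^esub> y" if "x \<in> S" for x using Upper_memD[OF y that S] by simp
    ultimately show ?thesis by (auto simp: product_frame_simps intro!: cl(3)[OF _ c])
  qed
qed

lemma product_frame_glb:
  assumes S: "S \<subseteq> carrier P"
  shows "greatest P (\<lambda>i\<in>I. \<Sqinter>\<^bsub>L i\<^esub> ((\<lambda>x. x i) ` S)) (Lower P S)" (is "greatest P ?s _")
proof (rule greatest_LowerI[OF _ _ S])
  have c: "(\<lambda>x. x i) ` S \<subseteq> carrier (L i)" if "i \<in> I" for i
    using that S by (auto simp: product_frame_simps)
  have cl: "\<Sqinter>\<^bsub>L i\<^esub> A \<in> carrier (L i)" "x \<in> A \<Longrightarrow> \<Sqinter>\<^bsub>L i\<^esub> A \<sqsubseteq>\<^bsub>L i\<^esub> x"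
    "\<lbrakk>y \<in> carrier (L i); \<And>x. x \<in> A \<Longrightarrow> y \<sqsubseteq>\<^bsub>L i\<^esub> x\<rbrakk> \<Longrightarrow> y \<sqsubseteq>\<^bsub>L i\<^esub> \<Sqinter>\<^bsub>L i\<^esub> A"
    if "i \<in> I" "A \<subseteq> carrier (L i)" for i A x y
  proof -
    interpret frame "L i" by (rule L[OF that(1)])
    show "\<Sqinter>\<^bsub>L i\<^esub> A \<in> carrier (L i)" using that(2) by simp
    show "x \<in> A \<Longrightarrow> \<Sqinter>\<^bsub>L i\<^esub> A \<sqsubseteq>\<^bsub>L i\<^esub> x" using that(2) by (rule inf_lower)
    show "\<lbrakk>y \<in> carrier (L i); \<And>x. x \<in> A \<Longrightarrow> y \<sqsubseteq>\<^bsub>L i\<^esub> x\<rbrakk> \<Longrightarrow> y \<sqsubseteq>\<^bsub>L i\<^esub> \<Sqinter>\<^bsub>L i\<^esub> A"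
      using that(2) by (intro inf_greatest)
  qed
  show "?s \<in> carrier P" using cl(1)[OF _ c] by (simp add: product_frame_simps)
  show "?s \<sqsubseteq>\<^bsub>P\<^esub> x" if "x \<in> S" for x
    using that cl(2)[OF _ c] by (auto simp: product_frame_simps)
  show "y \<sqsubseteq>\<^bsub>P\<^esub> ?s" if y: "y \<in> Lower P S" for y
  proof -
    have "y \<in> carrier P" using y subsetD[OF Lower_closed] by metis
    moreover have "y \<sqsubseteq>\<^bsub>P\<^esub> x" if "x \<in> S" for x using Lower_memD[OF y that S] by simp
    ultimately show ?thesis by (auto simp: product_frame_simps intro!: cl(3)[OF _ c])
  qed
qed

lemma product_frame_complete_lattice: "complete_lattice P"
proof -
  interpret partial_order P by (rule product_frame_partial_order)
  show ?thesis by unfold_locales (use product_frame_lub product_frame_glb in blast)+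
qed

lemma product_frame_sup:
  "S \<subseteq> carrier P \<Longrightarrow> \<Squnion>\<^bsub>P\<^esub> S = (\<lambda>i\<in>I. \<Squnion>\<^bsub>L i\<^esub> ((\<lambda>x. x i) ` S))"
proof -
  interpret complete_lattice P by (rule product_frame_complete_lattice)
  show "S \<subseteq> carrier P \<Longrightarrow> ?thesis" by (rule least_unique[OF sup_lub product_frame_lub])
qed

lemma product_frame_inf:
  "S \<subseteq> carrier P \<Longrightarrow> \<Sqinter>\<^bsub>P\<^esub> S = (\<lambda>i\<in>I. \<Sqinter>\<^bsub>L i\<^esub> ((\<lambda>x. x i) ` S))"
proof -
  interpret complete_lattice P by (rule product_frame_complete_lattice)
  show "S \<subseteq> carrier P \<Longrightarrow> ?thesis" by (rule greatest_unique[OF inf_glb product_frame_glb])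
qed

lemma product_frame_meet:
  "\<lbrakk>x \<in> carrier P; y \<in> carrier P\<rbrakk> \<Longrightarrow> x \<sqinter>\<^bsub>P\<^esub> y = (\<lambda>i\<in>I. x i \<sqinter>\<^bsub>L i\<^esub> y i)"
  by (simp add: meet_def product_frame_inf)

lemma product_frame_bottom: "\<bottom>\<^bsub>P\<^esub> = (\<lambda>i\<in>I. \<bottom>\<^bsub>L i\<^esub>)"
proof -
  interpret complete_lattice P by (rule product_frame_complete_lattice)
  \<comment> \<open>The bottom is the empty join, so the coordinatewise formula for joins applies to
    it.\<close>
  have "\<bottom>\<^bsub>P\<^esub> = \<Squnion>\<^bsub>P\<^esub> {}" using weak_sup_empty by (simp add: eq_is_equal)
  also have "\<dots> = (\<lambda>i\<in>I. \<bottom>\<^bsub>L i\<^esub>)"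
    using frame.sup_empty[OF L] by (simp add: product_frame_sup cong: restrict_cong)
  finally show ?thesis .
qed

lemma product_frame_top: "\<top>\<^bsub>P\<^esub> = (\<lambda>i\<in>I. \<top>\<^bsub>L i\<^esub>)"
proof -
  interpret complete_lattice P by (rule product_frame_complete_lattice)
  have top: "\<Sqinter>\<^bsub>L i\<^esub> {} = \<top>\<^bsub>L i\<^esub>" if "i \<in> I" for i
  proof -
    interpret Li: frame "L i" by (rule L[OF that])
    show ?thesis using Li.weak_inf_empty by (simp add: Li.eq_is_equal)
  qed
  have "\<top>\<^bsub>P\<^esub> = \<Sqinter>\<^bsub>P\<^esub> {}" using weak_inf_empty by (simp add: eq_is_equal)
  also have "\<dots> = (\<lambda>i\<in>I. \<top>\<^bsub>L i\<^esub>)"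
    using top by (simp add: product_frame_inf cong: restrict_cong)
  finally show ?thesis .
qed

lemma product_frame_frame: "frame P"
proof -
  interpret complete_lattice P by (rule product_frame_complete_lattice)
  show ?thesis
  proof
    fix a S assume a: "a \<in> carrier P" and S: "S \<subseteq> carrier P"
    have aS: "(\<lambda>s. a \<sqinter>\<^bsub>P\<^esub> s) ` S \<subseteq> carrier P" using a S by (auto intro!: meet_closed)
    \<comment> \<open>The distributive law of \<open>L i\<close>, with the coordinates at
      \<open>i\<close> of the meets in the product identified first.\<close>
    have eq: "a i \<sqinter>\<^bsub>L i\<^esub> \<Squnion>\<^bsub>L i\<^esub> ((\<lambda>x. x i) ` S) = \<Squnion>\<^bsub>L i\<^esub> ((\<lambda>x. x i) ` (\<lambda>s. a \<sqinter>\<^bsub>P\<^esub> s) ` S)"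
      if i: "i \<in> I" for i
    proof -
      have c: "a i \<in> carrier (L i)" "(\<lambda>x. x i) ` S \<subseteq> carrier (L i)"
        using a S i by (auto simp: product_frame_simps)
      have "(\<lambda>x. x i) ` (\<lambda>s. a \<sqinter>\<^bsub>P\<^esub> s) ` S = (\<lambda>s. a i \<sqinter>\<^bsub>L i\<^esub> s) ` (\<lambda>x. x i) ` S"
        unfolding image_image
        by (intro image_cong) (use product_frame_meet[OF a] S i in auto)
      then show ?thesis using frame.meet_sup_distrib[OF L[OF i] c] by simp
    qed
    have "a \<sqinter>\<^bsub>P\<^esub> \<Squnion>\<^bsub>P\<^esub> S = (\<lambda>i\<in>I. a i \<sqinter>\<^bsub>L i\<^esub> \<Squnion>\<^bsub>L i\<^esub> ((\<lambda>x. x i) ` S))"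
      unfolding product_frame_meet[OF a sup_closed[OF S]]
      by (rule restrict_ext) (simp add: product_frame_sup[OF S])
    also have "\<dots> = \<Squnion>\<^bsub>P\<^esub> ((\<lambda>s. a \<sqinter>\<^bsub>P\<^esub> s) ` S)"
      unfolding product_frame_sup[OF aS] by (rule restrict_ext) (rule eq)
    finally show "a \<sqinter>\<^bsub>P\<^esub> \<Squnion>\<^bsub>P\<^esub> S = \<Squnion>\<^bsub>P\<^esub> ((\<lambda>s. a \<sqinter>\<^bsub>P\<^esub> s) ` S)" .
  qed
qed

text \<open>The existence half of the universal property of the product; all lattice operations are
  coordinatewise.\<close>

lemma product_frame_pairing:
  assumes F: "frame F" and k: "\<And>i. i \<in> I \<Longrightarrow> frame_hom F (L i) (k i)"
  shows "frame_hom F P (\<lambda>x. \<lambda>i\<in>I. k i x)"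
proof -
  interpret F: frame F by (rule F)
  have closed: "(\<lambda>i\<in>I. k i x) \<in> carrier P" if "x \<in> carrier F" for x
    using frame_hom_closed[OF k that] by (auto simp: product_frame_simps)
  moreover have "(\<lambda>i\<in>I. k i \<top>\<^bsub>F\<^esub>) = \<top>\<^bsub>P\<^esub>"
    using frame_homD(1)[OF k] by (auto simp: product_frame_top)
  moreover have "(\<lambda>i\<in>I. k i (x \<sqinter>\<^bsub>F\<^esub> y)) = (\<lambda>i\<in>I. k i x) \<sqinter>\<^bsub>P\<^esub> (\<lambda>i\<in>I. k i y)"
    if "x \<in> carrier F" "y \<in> carrier F" for x y
    unfolding product_frame_meet[OF closed[OF that(1)] closed[OF that(2)]]
    using frame_homD(2)[OF k that] by (intro restrict_ext) simp
  moreover have "(\<lambda>i\<in>I. k i (\<Squnion>\<^bsub>F\<^esub> S)) = \<Squnion>\<^bsub>P\<^esub> ((\<lambda>x. \<lambda>i\<in>I. k i x) ` S)" if S: "S \<subseteq> carrier F" for S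
  proof -
    have "(\<lambda>x. \<lambda>i\<in>I. k i x) ` S \<subseteq> carrier P" using closed S by blast
    from product_frame_sup[OF this] show ?thesis
      using frame_homD(3)[OF k S] by (auto simp: image_image intro!: restrict_ext)
  qed
  ultimately show ?thesis
    using F product_frame_frame by (simp add: frame_hom_def)
qed

text \<open>The indicators of the nontrivial coordinates are a disjoint family of nonzero
  elements.\<close>

lemma countably_presented_product_imp_countable:
  assumes "countably_presented P"
  shows "countable {i \<in> I. \<not> trivial_frame (L i)}"
proof (rule countably_presented_disjoint_countable[OF assms])
  let ?e = "\<lambda>i. \<lambda>j\<in>I. if j = i then \<top>\<^bsub>L j\<^esub> else \<bottom>\<^bsub>L j\<^esub>"
  have tb: "\<top>\<^bsub>L i\<^esub> \<in> carrier (L i)" "\<bottom>\<^bsub>L i\<^esub> \<in> carrier (L i)"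
    "x \<in> carrier (L i) \<Longrightarrow> x \<sqinter>\<^bsub>L i\<^esub> \<bottom>\<^bsub>L i\<^esub> = \<bottom>\<^bsub>L i\<^esub>"
    "x \<in> carrier (L i) \<Longrightarrow> \<bottom>\<^bsub>L i\<^esub> \<sqinter>\<^bsub>L i\<^esub> x = \<bottom>\<^bsub>L i\<^esub>" if "i \<in> I" for i x
  proof -
    interpret frame "L i" by (rule L[OF that])
    show "\<top>\<^bsub>L i\<^esub> \<in> carrier (L i)" "\<bottom>\<^bsub>L i\<^esub> \<in> carrier (L i)" by simp_all
    show m: "x \<in> carrier (L i) \<Longrightarrow> x \<sqinter>\<^bsub>L i\<^esub> \<bottom>\<^bsub>L i\<^esub> = \<bottom>\<^bsub>L i\<^esub>" by (rule meet_bottom)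
    then show "x \<in> carrier (L i) \<Longrightarrow> \<bottom>\<^bsub>L i\<^esub> \<sqinter>\<^bsub>L i\<^esub> x = \<bottom>\<^bsub>L i\<^esub>" by (metis meet_comm)
  qed
  show e: "?e i \<in> carrier P" for i using tb by (auto simp: product_frame_simps)
  show "?e i \<noteq> \<bottom>\<^bsub>P\<^esub>" if i: "i \<in> {i \<in> I. \<not> trivial_frame (L i)}" for i
  proof
    assume "?e i = \<bottom>\<^bsub>P\<^esub>"
    \<comment> \<open>At its own coordinate the indicator is top, so top and bottom of
      \<open>L i\<close> would coincide and \<open>L i\<close> would be trivial.\<close>
    then have "?e i i = \<bottom>\<^bsub>P\<^esub> i" by simp
    then show False using i trivial_frame_iff[OF L, of i] by (simp add: product_frame_bottom)
  qed
  show "?e i \<sqinter>\<^bsub>P\<^esub> ?e j = \<bottom>\<^bsub>P\<^esub>" if "i \<noteq> j" for i j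
    unfolding product_frame_meet[OF e e] product_frame_bottom
    using that tb by (intro restrict_ext) auto
qed

end

section \<open>A presentation of a countable product\<close>

text \<open>
  The generator \<open>tag i 0\<close> stands for the element of the product that is top at \<open>i\<close> and bottom
  elsewhere, and \<open>tag i (Suc g)\<close> for the generator \<open>g\<close> of \<open>L i\<close> placed at \<open>i\<close>, bottom elsewhere.
\<close>

locale presented_family =
  fixes I :: "'i set" and L :: "'i \<Rightarrow> 'a gorder"
    and Gs :: "'i \<Rightarrow> nat set" and Rs :: "'i \<Rightarrow> (nat set set \<times> nat set set) set"
    and hs :: "'i \<Rightarrow> nat set set \<Rightarrow> 'a"
  assumes countable_nontrivial: "countable {i \<in> I. \<not> trivial_frame (L i)}"
    and countable_Rs: "\<And>i. i \<in> I \<Longrightarrow> countable (Rs i)"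
    and Rs_closed: "\<And>i. i \<in> I \<Longrightarrow> Rs i \<subseteq> carrier (free_frame (Gs i)) \<times> carrier (free_frame (Gs i))"
    and hs_hom: "\<And>i. i \<in> I \<Longrightarrow> frame_hom (free_frame (Gs i)) (L i) (hs i)"
    and hs_surj: "\<And>i. i \<in> I \<Longrightarrow> hs i ` carrier (free_frame (Gs i)) = carrier (L i)"
    and hs_ker: "\<And>i U V. \<lbrakk>i \<in> I; U \<in> carrier (free_frame (Gs i)); V \<in> carrier (free_frame (Gs i))\<rbrakk> \<Longrightarrow>
      hs i U = hs i V \<longleftrightarrow> (U, V) \<in> generated_congruence (free_frame (Gs i)) (Rs i)"
begin

definition J where "J = {i \<in> I. \<not> trivial_frame (L i)}"

definition tag :: "'i \<Rightarrow> nat \<Rightarrow> nat" where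
  "tag i n = prod_encode (to_nat_on J i, n)"

text \<open>Trivial coordinates contribute no generators, since their values are forced. This also
  keeps the indices within \<open>J\<close>, where \<open>to_nat_on J\<close> is injective.\<close>

definition G where "G = (\<Union>i\<in>J. insert (tag i 0) ((\<lambda>g. tag i (Suc g)) ` Gs i))"

definition E where "E i = free_gen G (tag i 0)"

text \<open>As a frame homomorphism, \<open>incl i\<close> sends the top to the top of the whole
  free frame and not to \<open>E i\<close>. The element \<open>A\<close> placed at coordinate
  \<open>i\<close> is therefore \<open>E i \<inter> incl i A\<close>.\<close>

definition incl where
  "incl i = (SOME h. frame_hom (free_frame (Gs i)) (free_frame G) h \<and>
     (\<forall>g\<in>Gs i. h (free_gen (Gs i) g) = free_gen G (tag i (Suc g))))"

text \<open>The value at coordinate \<open>i\<close> of the generator coded by \<open>n\<close>. The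
  test \<open>i \<in> J\<close> matters: outside \<open>J\<close> the number
  \<open>to_nat_on J i\<close> is unspecified and could be the code of an index in
  \<open>J\<close>.\<close>

definition proj_gen where
  "proj_gen i n = (if i \<in> J \<and> fst (prod_decode n) = to_nat_on J i
     then (case snd (prod_decode n) of 0 \<Rightarrow> Fpow (Gs i) | Suc g \<Rightarrow> free_gen (Gs i) g) else {})"

text \<open>It is a homomorphism for every \<open>i\<close>, also outside \<open>J\<close>, so that
  \<open>h\<close> has a component at each coordinate of the product.\<close>

definition proj where
  "proj i = (SOME h. frame_hom (free_frame G) (free_frame (Gs i)) h \<and>
     (\<forall>n\<in>G. h (free_gen G n) = proj_gen i n))"

text \<open>The relations of \<open>L i\<close> are cut down by \<open>E i\<close>: a relation with
  the top on one side would otherwise speak about the top of the whole product.\<close>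

inductive_set R :: "(nat set set \<times> nat set set) set" where
  disjoint: "\<lbrakk>i \<in> J; j \<in> J; i \<noteq> j\<rbrakk> \<Longrightarrow> (E i \<inter> E j, {}) \<in> R"
| cover: "(\<Union>i\<in>J. E i, Fpow G) \<in> R"
| below: "\<lbrakk>i \<in> J; g \<in> Gs i\<rbrakk> \<Longrightarrow> (E i \<inter> free_gen G (tag i (Suc g)), free_gen G (tag i (Suc g))) \<in> R"
| relation: "\<lbrakk>i \<in> J; (A, B) \<in> Rs i\<rbrakk> \<Longrightarrow> (E i \<inter> incl i A, E i \<inter> incl i B) \<in> R"

definition h where "h U = (\<lambda>i\<in>I. hs i (proj i U))"

abbreviation "\<theta> \<equiv> generated_congruence (free_frame G) R"

section \<open>Inclusions and projections between the free frames\<close>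

lemma J_sub: "i \<in> J \<Longrightarrow> i \<in> I"
  by (simp add: J_def)

lemma countable_J: "countable J"
  using countable_nontrivial by (simp add: J_def)

lemma trivial_outside:
  assumes "i \<in> I" "i \<notin> J" "x \<in> carrier (L i)" "y \<in> carrier (L i)"
  shows "x = y"
  using assms by (auto simp: J_def trivial_frame_def)

lemma tag_in_G: "i \<in> J \<Longrightarrow> tag i 0 \<in> G" "\<lbrakk>i \<in> J; g \<in> Gs i\<rbrakk> \<Longrightarrow> tag i (Suc g) \<in> G"
  by (auto simp: G_def)

lemma E_closed: "E i \<in> carrier (free_frame G)"
  unfolding E_def by (rule free_gen_closed)

lemma incl:
  assumes "i \<in> J"
  shows "frame_hom (free_frame (Gs i)) (free_frame G) (incl i)"
    and "g \<in> Gs i \<Longrightarrow> incl i (free_gen (Gs i) g) = free_gen G (tag i (Suc g))"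
proof -
  have "\<exists>h. frame_hom (free_frame (Gs i)) (free_frame G) h \<and>
      (\<forall>g\<in>Gs i. h (free_gen (Gs i) g) = free_gen G (tag i (Suc g)))"
    by (rule free_frame_extension[OF free_frame_frame]) (simp add: free_gen_closed)
  from someI_ex[OF this]
  show "frame_hom (free_frame (Gs i)) (free_frame G) (incl i)"
    and "g \<in> Gs i \<Longrightarrow> incl i (free_gen (Gs i) g) = free_gen G (tag i (Suc g))"
    unfolding incl_def by blast+
qed

lemma proj:
  shows "frame_hom (free_frame G) (free_frame (Gs i)) (proj i)"
    and "n \<in> G \<Longrightarrow> proj i (free_gen G n) = proj_gen i n"
proof -
  have "\<exists>h. frame_hom (free_frame G) (free_frame (Gs i)) h \<and>
      (\<forall>n\<in>G. h (free_gen G n) = proj_gen i n)"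
    by (rule free_frame_extension[OF free_frame_frame])
      (simp add: proj_gen_def free_gen_closed free_frame_empty_closed free_frame_Fpow_closed
        split: nat.split)
  from someI_ex[OF this]
  show "frame_hom (free_frame G) (free_frame (Gs i)) (proj i)"
    and "n \<in> G \<Longrightarrow> proj i (free_gen G n) = proj_gen i n"
    unfolding proj_def by blast+
qed

lemma incl_closed: "\<lbrakk>i \<in> J; A \<in> carrier (free_frame (Gs i))\<rbrakk> \<Longrightarrow> incl i A \<in> carrier (free_frame G)"
  using incl(1) frame_hom_closed by metis

lemma proj_closed: "U \<in> carrier (free_frame G) \<Longrightarrow> proj i U \<in> carrier (free_frame (Gs i))"
  using proj(1) frame_hom_closed by metis

text \<open>Decoding recovers the index because \<open>to_nat_on J\<close> is injective on the
  countable set \<open>J\<close>.\<close>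

lemma proj_gen_tag:
  assumes "j \<in> J"
  shows "proj_gen i (tag j n) = (if i = j then case n of 0 \<Rightarrow> Fpow (Gs i) | Suc g \<Rightarrow> free_gen (Gs i) g else {})"
proof -
  have "i \<in> J \<and> to_nat_on J j = to_nat_on J i \<longleftrightarrow> i = j"
    using assms to_nat_on_inj[OF countable_J] by metis
  then show ?thesis by (simp add: proj_gen_def tag_def)
qed

lemma proj_E: "j \<in> J \<Longrightarrow> proj i (E j) = (if i = j then Fpow (Gs i) else {})"
  unfolding E_def using proj(2)[OF tag_in_G(1)] by (simp add: proj_gen_tag)

lemma proj_tag:
  "\<lbrakk>j \<in> J; g \<in> Gs j\<rbrakk> \<Longrightarrow> proj i (free_gen G (tag j (Suc g))) = (if i = j then free_gen (Gs i) g else {})"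
  using proj(2)[OF tag_in_G(2)] by (simp add: proj_gen_tag)

text \<open>The composite and the identity agree on generators, hence everywhere by uniqueness of
  extensions.\<close>

lemma proj_incl:
  assumes "i \<in> J" "A \<in> carrier (free_frame (Gs i))"
  shows "proj i (incl i A) = A"
  by (rule free_frame_extension_unique[OF frame_hom_comp[OF incl(1)[OF assms(1)] proj(1)]
        frame_hom_id[OF free_frame_frame] _ assms(2)])
    (simp add: incl(2) proj_tag assms(1))

text \<open>\<open>E j\<close> projects to top at \<open>j\<close> and to bottom elsewhere, and
  \<open>proj j\<close> undoes \<open>incl j\<close>. This yields both the soundness of
  \<open>relation\<close> and the surjectivity of \<open>h\<close>.\<close>

lemma proj_E_Int_incl:
  assumes j: "j \<in> J" and A: "A \<in> carrier (free_frame (Gs j))"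
  shows "proj i (E j \<inter> incl j A) = (if i = j then A else {})"
proof -
  have "proj i (E j \<inter> incl j A) = proj i (E j) \<inter> proj i (incl j A)"
    by (rule free_frame_endo_homD(3)[OF proj(1) E_closed incl_closed[OF assms]])
  moreover have "A \<subseteq> Fpow (Gs j)" using free_frame_carrierD(1)[OF A] .
  ultimately show ?thesis using proj_E[OF j] proj_incl[OF assms] by auto
qed

section \<open>Well-formedness and countability of the relations\<close>

lemma R_closed: "R \<subseteq> carrier (free_frame G) \<times> carrier (free_frame G)"
proof (rule subrelI)
  fix U V assume "(U, V) \<in> R"
  then show "(U, V) \<in> carrier (free_frame G) \<times> carrier (free_frame G)"
  proof cases
    case cover
    have "E ` J \<subseteq> carrier (free_frame G)" using E_closed by (rule image_subsetI)
    from free_frame_Union_closed[OF this] show ?thesis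
      unfolding cover by (intro SigmaI free_frame_Fpow_closed)
  next
    case (relation i A B)
    have "A \<in> carrier (free_frame (Gs i))" "B \<in> carrier (free_frame (Gs i))"
      using subsetD[OF Rs_closed[OF J_sub[OF relation(3)]] relation(4)] by simp_all
    then show ?thesis
      unfolding relation(1,2) by (intro SigmaI free_frame_Int_closed E_closed incl_closed relation(3))
  qed (simp_all add: free_frame_Int_closed E_closed free_frame_empty_closed free_gen_closed)
qed

text \<open>Besides the single covering relation, the relations are indexed by pairs from
  \<open>J\<close>, by an index with a natural number, and by an index with a member of the
  countable set \<open>Rs i\<close>.\<close>

lemma countable_R: "countable R"
proof (rule countable_subset)
  let ?D = "(\<lambda>(i, j). (E i \<inter> E j, {})) ` (J \<times> J)"
  let ?B = "(\<lambda>(i, g). (E i \<inter> free_gen G (tag i (Suc g)), free_gen G (tag i (Suc g)))) ` Sigma J Gs"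
  let ?S = "(\<lambda>(i, A, B). (E i \<inter> incl i A, E i \<inter> incl i B)) ` Sigma J Rs"
  show "R \<subseteq> ?D \<union> {(\<Union>i\<in>J. E i, Fpow G)} \<union> ?B \<union> ?S"
  proof (rule subrelI)
    fix U V assume "(U, V) \<in> R"
    then show "(U, V) \<in> ?D \<union> {(\<Union>i\<in>J. E i, Fpow G)} \<union> ?B \<union> ?S"
    proof cases
      case (disjoint i j)
      have "(U, V) \<in> ?D" by (rule image_eqI[of _ _ "(i, j)"]) (simp_all add: disjoint)
      then show ?thesis by simp
    next
      case cover
      then show ?thesis by simp
    next
      case (below i g)
      have "(U, V) \<in> ?B" by (rule image_eqI[of _ _ "(i, g)"]) (simp_all add: below)
      then show ?thesis by simp
    next
      case (relation i A B)
      have "(U, V) \<in> ?S" by (rule image_eqI[of _ _ "(i, A, B)"]) (simp_all add: relation)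
      then show ?thesis by simp
    qed
  qed
  have "countable (Sigma J Rs)" using countable_J countable_Rs[OF J_sub] by (rule countable_SIGMA)
  moreover have "countable (Sigma J Gs)" using countable_J by (intro countable_SIGMA) simp_all
  ultimately show "countable (?D \<union> {(\<Union>i\<in>J. E i, Fpow G)} \<union> ?B \<union> ?S)"
    using countable_J by (intro countable_Un countable_image) simp_all
qed

lemma theta: "frame_congruence (free_frame G) \<theta>"
  by (rule generated_congruence(1)[OF free_frame_frame R_closed])

lemma R_theta: "p \<in> R \<Longrightarrow> p \<in> \<theta>"
  using generated_congruence(2)[OF free_frame_frame R_closed] by blast

section \<open>Soundness: the relations hold in the product\<close>

lemma h_hom: "frame_hom (free_frame G) (product_frame I L) h"
  unfolding h_def
  by (rule product_frame_pairing[OF frame_hom_frames(2)[OF hs_hom] free_frame_frame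
        frame_hom_comp[OF proj(1) hs_hom]])

text \<open>A coordinate outside \<open>J\<close> has only one possible value, so it cannot
  distinguish two images.\<close>

lemma h_eq_iff:
  assumes "U \<in> carrier (free_frame G)" "V \<in> carrier (free_frame G)"
  shows "h U = h V \<longleftrightarrow> (\<forall>i\<in>J. hs i (proj i U) = hs i (proj i V))"
proof
  assume eq: "h U = h V"
  show "\<forall>i\<in>J. hs i (proj i U) = hs i (proj i V)"
  proof
    fix i assume "i \<in> J"
    moreover have "h U i = h V i" by (simp only: eq)
    ultimately show "hs i (proj i U) = hs i (proj i V)" using J_sub by (simp add: h_def)
  qed
next
  assume eq: "\<forall>i\<in>J. hs i (proj i U) = hs i (proj i V)"
  have "hs i (proj i U) = hs i (proj i V)" if "i \<in> I" for i
    using eq trivial_outside[OF that] proj_closed assms frame_hom_closed[OF hs_hom[OF that]] by blast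
  then show "h U = h V" unfolding h_def by (rule restrict_ext)
qed

text \<open>Each kind of relation is checked at one coordinate \<open>i\<close>, where
  \<open>proj\<close> turns every \<open>E j\<close> into top or bottom.\<close>

lemma h_relation:
  assumes UV: "(U, V) \<in> R"
  shows "h U = h V"
proof -
  have c: "U \<in> carrier (free_frame G)" "V \<in> carrier (free_frame G)" using UV R_closed by auto
  have "hs i (proj i U) = hs i (proj i V)" if i: "i \<in> J" for i
    using UV
  proof cases
    \<comment> \<open>At most one of \<open>j\<close> and \<open>k\<close> equals \<open>i\<close>,
      so one of the two factors projects to bottom.\<close>
    case (disjoint j k)
    then show ?thesis
      using free_frame_endo_homD(2,3)[OF proj(1)] by (simp add: E_closed proj_E)
  next
    case cover
    have "proj i (\<Union>(E ` J)) = \<Union>(proj i ` E ` J)"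
      by (rule free_frame_endo_homD(4)[OF proj(1)]) (use E_closed in blast)
    \<comment> \<open>The member \<open>E i\<close> of the cover already projects to the
      top.\<close>
    also have "\<dots> = Fpow (Gs i)" using i by (auto simp: proj_E split: if_splits)
    finally show ?thesis using cover free_frame_endo_homD(1)[OF proj(1)] by simp
  next
    case (below j g)
    \<comment> \<open>At \<open>i = j\<close> meeting with \<open>E j\<close> becomes meeting with
      the top, which changes nothing; elsewhere both sides are bottom.\<close>
    have "free_gen (Gs i) g \<subseteq> Fpow (Gs i)" by (auto simp: free_gen_def)
    then show ?thesis
      using below free_frame_endo_homD(3)[OF proj(1)]
      by (auto simp: E_closed free_gen_closed proj_E proj_tag Int_absorb1)
  next
    case (relation j A B)
    then have AB: "A \<in> carrier (free_frame (Gs j))" "B \<in> carrier (free_frame (Gs j))"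
      using Rs_closed[OF J_sub] by auto
    \<comment> \<open>At \<open>i = j\<close> the relation reduces to the given relation of
      \<open>L j\<close>; elsewhere both sides are bottom.\<close>
    have "(A, B) \<in> generated_congruence (free_frame (Gs j)) (Rs j)"
      using generated_congruence(2)[OF free_frame_frame Rs_closed] relation J_sub by blast
    then have "hs j A = hs j B" using hs_ker[OF J_sub AB] relation by simp
    then show ?thesis
      using relation proj_E_Int_incl AB by simp
  qed
  then show ?thesis using h_eq_iff[OF c] by blast
qed

text \<open>The kernel of \<open>h\<close> is a congruence containing \<open>R\<close>, hence it
  contains the least such congruence.\<close>

lemma h_theta:
  assumes "(U, V) \<in> \<theta>"
  shows "h U = h V"
proof -
  have "R \<subseteq> {(U, V) \<in> carrier (free_frame G) \<times> carrier (free_frame G). h U = h V}"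
    using R_closed h_relation by auto
  from generated_congruence_least[OF frame_congruence_kernel[OF h_hom] this]
  show ?thesis using assms by auto
qed

section \<open>Completeness: elements with equal images are congruent\<close>

text \<open>
  Both sides are frame homomorphisms from the free frame to the elements of the quotient below
  \<open>E i\<close>, so it is enough to compare them on generators.
\<close>

lemma theta_localize:
  assumes i: "i \<in> J" and "U \<in> carrier (free_frame G)"
  shows "(E i \<inter> U, E i \<inter> incl i (proj i U)) \<in> \<theta>"
  using assms(2)
proof (induction rule: free_frame_induct)
  note refl = frame_congruence_refl[OF theta] and trans = frame_congruence_trans[OF theta]
    and Int = free_congruence_Int[OF theta] and sym = frame_congruence_sym[OF theta]
  case (gen n)
  then obtain j where j: "j \<in> J" and n: "n = tag j 0 \<or> (\<exists>g\<in>Gs j. n = tag j (Suc g))"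
    by (auto simp: G_def)
  show ?case
  proof (cases "i = j")
    case True
    from n show ?thesis
    proof
      assume "n = tag j 0"
      \<comment> \<open>The generator is \<open>E i\<close> itself; it projects to the top, which
        \<open>incl i\<close> preserves.\<close>
      then have "E i \<inter> free_gen G n = E i" "E i \<inter> incl i (proj i (free_gen G n)) = E i"
        using True i free_frame_carrierD(1)[OF E_closed] proj_E[OF i, of i]
          free_frame_endo_homD(1)[OF incl(1)[OF i]]
        by (auto simp: E_def)
      then show ?thesis using refl[OF E_closed] by simp
    next
      assume "\<exists>g\<in>Gs j. n = tag j (Suc g)"
      \<comment> \<open>A generator of \<open>L i\<close> placed at \<open>i\<close> returns to
        itself, so both sides are literally equal.\<close>
      then have "incl i (proj i (free_gen G n)) = free_gen G n"
        using True i proj_tag[OF i] incl(2)[OF i] by auto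
      then show ?thesis using refl free_frame_Int_closed[OF E_closed free_gen_closed] by simp
    qed
  next
    case False
    \<comment> \<open>Modulo \<open>\<theta>\<close> every generator tagged \<open>j\<close> lies
      below \<open>E j\<close>, which is disjoint from \<open>E i\<close>; so the left side
      collapses to bottom, and the right side is bottom because \<open>proj i\<close> kills the
      generator.\<close>
    have "(E j \<inter> free_gen G n, free_gen G n) \<in> \<theta>"
      using n R_theta[OF R.below[OF j]] refl[OF E_closed] by (auto simp: E_def)
    from Int[OF refl[OF E_closed] sym[OF this]]
    have "(E i \<inter> free_gen G n, (E i \<inter> E j) \<inter> free_gen G n) \<in> \<theta>" by (simp only: Int_assoc)
    moreover have "((E i \<inter> E j) \<inter> free_gen G n, {} \<inter> free_gen G n) \<in> \<theta>"
      by (rule Int[OF R_theta[OF R.disjoint[OF i j False]] refl[OF free_gen_closed]])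
    ultimately have "(E i \<inter> free_gen G n, {}) \<in> \<theta>" using trans by simp
    moreover have "proj i (free_gen G n) = {}"
      using n proj_tag[OF j, of _ i] proj_E[OF j, of i] False by (auto simp: E_def)
    ultimately show ?thesis using free_frame_endo_homD(2)[OF incl(1)[OF i]] by simp
  qed
next
  case top
  show ?case
    using frame_congruence_refl[OF theta free_frame_Int_closed[OF E_closed free_frame_Fpow_closed]]
      free_frame_endo_homD(1)[OF proj(1)] free_frame_endo_homD(1)[OF incl(1)[OF i]] by simp
next
  case (meet U V)
  have "incl i (proj i (U \<inter> V)) = incl i (proj i U) \<inter> incl i (proj i V)"
    using meet.hyps free_frame_endo_homD(3)[OF proj(1)] free_frame_endo_homD(3)[OF incl(1)[OF i]]
      proj_closed by simp
  then show ?case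
    using free_congruence_Int[OF theta meet.IH] by (simp add: Int_ac)
next
  case (sup S)
  have "proj i ` S \<subseteq> carrier (free_frame (Gs i))" using sup.hyps proj_closed by blast
  then have "incl i (proj i (\<Union>S)) = (\<Union>U\<in>S. incl i (proj i U))"
    using sup.hyps free_frame_endo_homD(4)[OF proj(1)] free_frame_endo_homD(4)[OF incl(1)[OF i]]
    by (simp add: image_image)
  moreover have "(\<Union>U\<in>S. E i \<inter> U, \<Union>U\<in>S. E i \<inter> incl i (proj i U)) \<in> \<theta>"
    by (rule free_congruence_UN[OF theta sup.IH])
  ultimately show ?case by (simp only: Int_Union image_image)
qed

text \<open>The pullback of \<open>\<theta>\<close> along
  \<open>A \<mapsto> E i \<inter> incl i A\<close> is a congruence containing \<open>Rs i\<close>,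
  by the relations of kind \<open>relation\<close>.\<close>

lemma theta_incl:
  assumes i: "i \<in> J" and AB: "(A, B) \<in> generated_congruence (free_frame (Gs i)) (Rs i)"
  shows "(E i \<inter> incl i A, E i \<inter> incl i B) \<in> \<theta>"
proof -
  let ?F = "free_frame (Gs i)"
  let ?K = "{(A, B) \<in> carrier ?F \<times> carrier ?F. (E i \<inter> incl i A, E i \<inter> incl i B) \<in> \<theta>}"
  have closed: "E i \<inter> incl i A \<in> carrier (free_frame G)" if "A \<in> carrier ?F" for A
    using free_frame_Int_closed[OF E_closed incl_closed[OF i that]] .
  have "frame_congruence ?F ?K"
  proof (rule frame_congruence_pullback[OF free_frame_frame theta closed])
    fix A B assume AB: "A \<in> carrier ?F" "B \<in> carrier ?F"
    show "E i \<inter> incl i (A \<sqinter>\<^bsub>?F\<^esub> B) = (E i \<inter> incl i A) \<sqinter>\<^bsub>free_frame G\<^esub> (E i \<inter> incl i B)"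
      unfolding free_frame_meet[OF AB] free_frame_meet[OF closed[OF AB(1)] closed[OF AB(2)]]
        free_frame_endo_homD(3)[OF incl(1)[OF i] AB] by blast
  next
    fix S assume S: "S \<subseteq> carrier ?F"
    then have c: "(\<lambda>A. E i \<inter> incl i A) ` S \<subseteq> carrier (free_frame G)"
      by (intro image_subsetI) (rule closed, erule subsetD)
    show "E i \<inter> incl i (\<Squnion>\<^bsub>?F\<^esub> S) = \<Squnion>\<^bsub>free_frame G\<^esub> ((\<lambda>A. E i \<inter> incl i A) ` S)"
      unfolding free_frame_sup[OF S] free_frame_sup[OF c] free_frame_endo_homD(4)[OF incl(1)[OF i] S]
      by blast
  qed
  moreover have "Rs i \<subseteq> ?K"
    using Rs_closed[OF J_sub[OF i]] R_theta[OF R.relation[OF i]] by auto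
  ultimately have "generated_congruence ?F (Rs i) \<subseteq> ?K" by (rule generated_congruence_least)
  then show ?thesis using AB by auto
qed

text \<open>Meet the covering relation with \<open>U\<close> and distribute.\<close>

lemma theta_cover:
  assumes "U \<in> carrier (free_frame G)"
  shows "(\<Union>i\<in>J. E i \<inter> U, U) \<in> \<theta>"
proof -
  have "((\<Union>i\<in>J. E i) \<inter> U, Fpow G \<inter> U) \<in> \<theta>"
    by (rule free_congruence_Int[OF theta R_theta[OF R.cover] frame_congruence_refl[OF theta assms]])
  moreover have "Fpow G \<inter> U = U" using free_frame_carrierD(1)[OF assms] by blast
  ultimately show ?thesis by simp
qed

text \<open>Modulo \<open>\<theta>\<close>, \<open>U\<close> is the join of its pieces below the
  \<open>E i\<close>, and each piece depends only on the class of \<open>proj i U\<close>, which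
  \<open>hs i\<close> detects.\<close>

lemma h_eq_imp_theta:
  assumes U: "U \<in> carrier (free_frame G)" and V: "V \<in> carrier (free_frame G)" and eq: "h U = h V"
  shows "(U, V) \<in> \<theta>"
proof -
  note trans = frame_congruence_trans[OF theta] and sym = frame_congruence_sym[OF theta]
  have "(E i \<inter> U, E i \<inter> V) \<in> \<theta>" if i: "i \<in> J" for i
  proof -
    have "hs i (proj i U) = hs i (proj i V)" using h_eq_iff[OF U V] eq i by blast
    then have "(proj i U, proj i V) \<in> generated_congruence (free_frame (Gs i)) (Rs i)"
      using hs_ker[OF J_sub[OF i] proj_closed[OF U] proj_closed[OF V]] by simp
    \<comment> \<open>The chain runs from \<open>E i \<inter> U\<close> through the localized
      projections of \<open>U\<close> and of \<open>V\<close> to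
      \<open>E i \<inter> V\<close>.\<close>
    from trans[OF theta_localize[OF i U] trans[OF theta_incl[OF i this] sym[OF theta_localize[OF i V]]]]
    show ?thesis .
  qed
  then have "(\<Union>i\<in>J. E i \<inter> U, \<Union>i\<in>J. E i \<inter> V) \<in> \<theta>" by (rule free_congruence_UN[OF theta])
  from trans[OF sym[OF theta_cover[OF U]] trans[OF this theta_cover[OF V]]] show ?thesis .
qed

section \<open>Surjectivity onto the product and the resulting presentation\<close>

lemma h_surj: "h ` carrier (free_frame G) = carrier (product_frame I L)"
proof
  show "h ` carrier (free_frame G) \<subseteq> carrier (product_frame I L)"
    by (rule frame_hom_image[OF h_hom order_refl])
  show "carrier (product_frame I L) \<subseteq> h ` carrier (free_frame G)"
  proof
    fix x assume x: "x \<in> carrier (product_frame I L)"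
    then have xi: "x i \<in> carrier (L i)" if "i \<in> I" for i
      using that by (auto simp: product_frame_simps)
    then have "\<exists>A. A \<in> carrier (free_frame (Gs i)) \<and> hs i A = x i" if "i \<in> I" for i
      using hs_surj[OF that] that by (metis imageE)
    then obtain A where A: "\<And>i. i \<in> I \<Longrightarrow> A i \<in> carrier (free_frame (Gs i))"
      and hA: "\<And>i. i \<in> I \<Longrightarrow> hs i (A i) = x i" by metis
    let ?f = "\<lambda>j. E j \<inter> incl j (A j)"
    \<comment> \<open>A preimage of \<open>x\<close> is the join of the preimages \<open>A j\<close>
      of its coordinates, each placed at its own coordinate.\<close>
    define U where "U = \<Union>(?f ` J)"
    have f: "?f ` J \<subseteq> carrier (free_frame G)"
      using free_frame_Int_closed[OF E_closed incl_closed[OF _ A[OF J_sub]]] by auto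
    then have U: "U \<in> carrier (free_frame G)" unfolding U_def by (rule free_frame_Union_closed)
    have "hs i (proj i U) = x i" if i: "i \<in> I" for i
    proof (cases "i \<in> J")
      case True
      have "proj i U = (\<Union>j\<in>J. proj i (?f j))"
        unfolding U_def free_frame_endo_homD(4)[OF proj(1) f] image_image ..
      \<comment> \<open>Pieces placed at other coordinates project to bottom.\<close>
      also have "\<dots> = (\<Union>j\<in>J. if i = j then A j else {})"
        using proj_E_Int_incl A J_sub by (intro SUP_cong) simp_all
      also have "\<dots> = A i" using True by auto
      finally show ?thesis using hA[OF i] by simp
    next
      \<comment> \<open>No piece of \<open>U\<close> is placed at \<open>i\<close>, but
        \<open>L i\<close> is trivial and has only the value \<open>x i\<close>.\<close>
      case False
      then show ?thesis
        using trivial_outside[OF i _ _ xi[OF i]] proj_closed[OF U] frame_hom_closed[OF hs_hom[OF i]]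
        by blast
    qed
    then have "h U = x"
      using x by (auto simp: h_def product_frame_simps intro!: PiE_ext[of _ I "\<lambda>i. carrier (L i)"])
    then show "x \<in> h ` carrier (free_frame G)" using U by blast
  qed
qed

lemma countably_presented_product: "countably_presented (product_frame I L)"
proof -
  have "\<forall>U\<in>carrier (free_frame G). \<forall>V\<in>carrier (free_frame G). h U = h V \<longleftrightarrow> (U, V) \<in> \<theta>"
    by (intro ballI iffI) (rule h_eq_imp_theta, assumption+, rule h_theta)
  then show ?thesis
    unfolding countably_presented_iff
    by (intro exI[of _ G] exI[of _ R] exI[of _ h] conjI countable_R R_closed h_hom h_surj)
qed

end

theorem theorem4p6:
  fixes I :: "'i set" and L :: "'i \<Rightarrow> 'a gorder"
  assumes "\<And>i. i \<in> I \<Longrightarrow> countably_presented (L i)"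
  shows "countably_presented (product_frame I L) \<longleftrightarrow> countable {i \<in> I. \<not> trivial_frame (L i)}"
proof
  assume "countably_presented (product_frame I L)"
  then show "countable {i \<in> I. \<not> trivial_frame (L i)}"
    using assms by (intro countably_presented_product_imp_countable) (simp_all add: countably_presented_def)
next
  assume countable: "countable {i \<in> I. \<not> trivial_frame (L i)}"
  \<comment> \<open>Presentations of all \<open>L i\<close> are chosen at once, as triples of
    generators, relations and quotient map.\<close>
  have "\<forall>i. \<exists>p. i \<in> I \<longrightarrow> (case p of (G :: nat set, R, h) \<Rightarrow>
      countable R \<and> R \<subseteq> carrier (free_frame G) \<times> carrier (free_frame G) \<and>
      frame_hom (free_frame G) (L i) h \<and> h ` carrier (free_frame G) = carrier (L i) \<and>
      (\<forall>U\<in>carrier (free_frame G). \<forall>V\<in>carrier (free_frame G).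
         h U = h V \<longleftrightarrow> (U, V) \<in> generated_congruence (free_frame G) R))"
    using assms by (simp add: countably_presented_iff)
  from choice[OF this] obtain p where p: "\<And>i. i \<in> I \<Longrightarrow> case p i of (G :: nat set, R, h) \<Rightarrow>
      countable R \<and> R \<subseteq> carrier (free_frame G) \<times> carrier (free_frame G) \<and>
      frame_hom (free_frame G) (L i) h \<and> h ` carrier (free_frame G) = carrier (L i) \<and>
      (\<forall>U\<in>carrier (free_frame G). \<forall>V\<in>carrier (free_frame G).
         h U = h V \<longleftrightarrow> (U, V) \<in> generated_congruence (free_frame G) R)" by (elim exE) auto
  interpret presented_family I L "\<lambda>i. fst (p i)" "\<lambda>i. fst (snd (p i))" "\<lambda>i. snd (snd (p i))"
    by standard (use countable p in \<open>auto simp only: split_beta\<close>)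
  show "countably_presented (product_frame I L)" by (rule countably_presented_product)
qed

end
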